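(* Let $1\le p<\infty$ and let $T_1=T_{f_1,w_1}$, $T_2=T_{f_2,w_2}$ be unilateral pseudo-shifts on $\ell^p(\mathbb{N})$. If $\mathcal{A}_{uBd}$ is $(f_1,f_2)$-almost partition regular and $f_1=f_2$, then $T_1,T_2$ are disjoint reiteratively hypercyclic if and only if $T_1$ and $T_2$ are (each) reiteratively hypercyclic and $T_1,T_2$ are disjoint hypercyclic.
   Context: $\mathbb{N}=\{1,2,\dots\}$, $[l]=\{1,\dots,l\}$; $\ell^p(\mathbb{N})$ is over $\mathbb{K}=\mathbb{R}$ or $\mathbb{C}$ with canonical basis $(e_j)_{j\ge1}$. $f^n$ is the $n$-th iterate of $f$. Pseudo-shift: for a bounded weight sequence of scalars $w=(w_j)_{j\in\mathbb{N}}$ and a strictly increasing $f:\mathbb{N}\to\mathbb{N}$ with $f(1)>1$, $T_{f,w}\big(\sum_{j\ge1}x_je_j\big)=\sum_{j\ge1}w_{f(j)}x_{f(j)}e_j$. For $A\subset\mathbb{N}$, $\overline{\mathrm{Bd}}\,A=\limsup_{M\to\infty}\max_{k\ge1}\frac{\mathrm{card}(A\cap\{k+1,\dots,k+M\})}{M}$; $\mathcal{A}_{uBd}$ is the family of subsets of $\mathbb{N}$ of positive upper Banach density. A family $\mathcal{A}$ of subsets of $\mathbb{N}$ is $(f_1,f_2)$-almost partition regular if for any $l\ge1$ and any $B\in\mathcal{A}$ there exists $A\subseteq B$ with $A\in\mathcal{A}$ such that $f_s^m([l])\cap f_t^n([l])=\emptyset$ for all $m,n\in A$ with $m\ne n$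 and all $s,t\in\{1,2\}$. An operator $T$ on $X$ is reiteratively hypercyclic if there is $x\in X$ such that $\{n:T^nx\in U\}\in\mathcal{A}_{uBd}$ for every non-empty open $U\subset X$. Operators $T_1,T_2$ on $X$ are disjoint reiteratively hypercyclic (resp. disjoint hypercyclic) if there is $x\in X$ such that for all non-empty open $V_1,V_2\subset X$ the set $\{n:T_1^nx\in V_1\text{ and }T_2^nx\in V_2\}$ has positive upper Banach density (resp. is infinite; equivalently, $\{(T_1^nx,T_2^nx):n\in\mathbb{N}\}$ is dense in $X\times X$). *)

theory Defs
  imports "HOL-Analysis.Analysis"
begin

text \<open>
  Throughout, the index set is \<open>{1..}\<close> inside \<^typ>\<open>nat\<close>. A scalar sequence indexed by
  \<open>{1..}\<close> is a function on \<^typ>\<open>nat\<close> whose value at the unused index \<open>0\<close> is \<open>0\<close>; this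
  makes the representation unique. For maps \<open>f\<close> and weights \<open>w\<close> the value at \<open>0\<close> is never
  used. The scalar sort \<open>{real_normed_field, euclidean_space}\<close> describes exactly the
  real and the complex field (the only finite-dimensional field extensions of the reals).
\<close>

section \<open>The spaces of p-summable sequences\<close>

definition lp_space :: "real \<Rightarrow> (nat \<Rightarrow> 'k::{real_normed_field, euclidean_space}) set" where
  "lp_space p = {x. x 0 = 0 \<and> summable (\<lambda>j. norm (x j) powr p)}"

definition lp_norm :: "real \<Rightarrow> (nat \<Rightarrow> 'k::{real_normed_field, euclidean_space}) \<Rightarrow> real" where
  "lp_norm p x = (\<Sum>j. norm (x j) powr p) powr (1 / p)"

definition lp_dist ::
  "real \<Rightarrow> (nat \<Rightarrow> 'k::{real_normed_field, euclidean_space}) \<Rightarrow> (nat \<Rightarrow> 'k) \<Rightarrow> real" where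
  "lp_dist p x y = lp_norm p (\<lambda>j. x j - y j)"

definition lp_topology :: "real \<Rightarrow> (nat \<Rightarrow> 'k::{real_normed_field, euclidean_space}) topology" where
  "lp_topology p = Metric_space.mtopology (lp_space p) (lp_dist p)"

lemma powr_convex_nonneg:
  fixes a b t p :: real
  assumes "1 \<le> p" "0 \<le> a" "0 \<le> b" "0 \<le> t" "t \<le> 1"
  shows "((1 - t) * a + t * b) powr p \<le> (1 - t) * a powr p + t * b powr p"
proof -
  have shrink: "(s * c) powr p \<le> s * c powr p" if "0 \<le> s" "s \<le> 1" "0 \<le> c" for s c :: real
  proof -
    have "s powr p \<le> s"
    proof (cases "s = 0")
      case False
      then show ?thesis using powr_mono'[of 1 p s] that assms(1) by simp
    qed simp
    then show ?thesis using that by (simp add: powr_mult mult_right_mono)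
  qed
  consider "a = 0" | "b = 0" | "0 < a" "0 < b" using assms by linarith
  then show ?thesis
  proof cases
    case 1
    then show ?thesis using shrink[of t b] assms by simp
  next
    case 2
    then show ?thesis using shrink[of "1 - t" a] assms by simp
  next
    case 3
    then show ?thesis
      using convex_onD[OF powr_convex[OF assms(1)], of t a b] assms by simp
  qed
qed

lemma minkowski_suminf:
  fixes a b :: "nat \<Rightarrow> real"
  assumes p: "1 \<le> p" and a: "\<And>j. 0 \<le> a j" and b: "\<And>j. 0 \<le> b j"
    and sa: "summable (\<lambda>j. a j powr p)" and sb: "summable (\<lambda>j. b j powr p)"
  shows "summable (\<lambda>j. (a j + b j) powr p)"
    and "(\<Sum>j. (a j + b j) powr p) powr (1 / p)
           \<le> (\<Sum>j. a j powr p) powr (1 / p) + (\<Sum>j. b j powr p) powr (1 / p)"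
proof -
  define A where "A = (\<Sum>j. a j powr p) powr (1 / p)"
  define B where "B = (\<Sum>j. b j powr p) powr (1 / p)"
  have Ap: "A powr p = (\<Sum>j. a j powr p)" and Bp: "B powr p = (\<Sum>j. b j powr p)"
    using p suminf_nonneg[OF sa] suminf_nonneg[OF sb] by (simp_all add: A_def B_def powr_powr)
  have zero: "c j = 0" if "summable (\<lambda>j. c j powr p)" "(\<Sum>j. c j powr p) = 0"
    for c :: "nat \<Rightarrow> real" and j
    using suminf_eq_zero_iff[OF that(1)] that(2) by simp
  have "summable (\<lambda>j. (a j + b j) powr p) \<and> (\<Sum>j. (a j + b j) powr p) powr (1 / p) \<le> A + B"
  proof (cases "A = 0 \<or> B = 0")
    case True
    then show ?thesis
    proof
      assume "A = 0"
      then have "a j = 0" for j using zero[OF sa] Ap by simp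
      then show ?thesis using sb by (simp add: A_def B_def)
    next
      assume "B = 0"
      then have "b j = 0" for j using zero[OF sb] Bp by simp
      then show ?thesis using sa by (simp add: A_def B_def)
    qed
  next
    case False
    then have A: "A > 0" and B: "B > 0" by (simp_all add: A_def B_def less_le)
    define t where "t = B / (A + B)"
    have t: "0 \<le> t" "t \<le> 1" "1 - t = A / (A + B)"
      using A B by (simp_all add: t_def field_simps)
    let ?g = "\<lambda>j. (A + B) powr p * ((1 - t) * (a j powr p / A powr p) + t * (b j powr p / B powr p))"
    have le: "(a j + b j) powr p \<le> ?g j" for j
    proof -
      have "a j + b j = (A + B) * ((1 - t) * (a j / A) + t * (b j / B))"
      proof -
        have "(1 - t) * (a j / A) = a j / (A + B)" "t * (b j / B) = b j / (A + B)"
          unfolding t(3) unfolding t_def using A B by auto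
        then show ?thesis using A B by (simp add: add_divide_distrib [symmetric])
      qed
      then have "(a j + b j) powr p
          = (A + B) powr p * ((1 - t) * (a j / A) + t * (b j / B)) powr p"
        using A B a b t by (simp add: powr_mult)
      also have "\<dots> \<le> (A + B) powr p * ((1 - t) * (a j / A) powr p + t * (b j / B) powr p)"
        using powr_convex_nonneg[OF p, of "a j / A" "b j / B" t] A B a b t
        by (intro mult_left_mono) auto
      finally show ?thesis using A B a b by (simp add: powr_divide)
    qed
    have "(\<lambda>j. a j powr p / A powr p) sums (A powr p / A powr p)"
      "(\<lambda>j. b j powr p / B powr p) sums (B powr p / B powr p)"
      unfolding Ap Bp by (intro sums_divide summable_sums sa sb)+
    then have "(\<lambda>j. (1 - t) * (a j powr p / A powr p) + t * (b j powr p / B powr p))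
        sums ((1 - t) * 1 + t * 1)"
      using A B by (intro sums_add sums_mult) auto
    then have g: "?g sums ((A + B) powr p)"
      using sums_mult[of _ 1 "(A + B) powr p"] by simp
    have s: "summable (\<lambda>j. (a j + b j) powr p)"
      by (rule summable_comparison_test'[OF sums_summable[OF g], of 0]) (use le in auto)
    have "(\<Sum>j. (a j + b j) powr p) \<le> (A + B) powr p"
      using suminf_le[OF le s sums_summable[OF g]] sums_unique[OF g] by simp
    then have "(\<Sum>j. (a j + b j) powr p) powr (1 / p) \<le> ((A + B) powr p) powr (1 / p)"
      using p suminf_nonneg[OF s] by (intro powr_mono2) auto
    then show ?thesis using s A B p by (simp add: powr_powr)
  qed
  then show "summable (\<lambda>j. (a j + b j) powr p)"
    and "(\<Sum>j. (a j + b j) powr p) powr (1 / p)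
           \<le> (\<Sum>j. a j powr p) powr (1 / p) + (\<Sum>j. b j powr p) powr (1 / p)"
    by (auto simp: A_def B_def)
qed

lemma lp_space_add:
  fixes x y :: "nat \<Rightarrow> 'k::{real_normed_field, euclidean_space}"
  assumes p: "1 \<le> p" and x: "x \<in> lp_space p" and y: "y \<in> lp_space p"
  shows "(\<lambda>j. x j + y j) \<in> lp_space p"
    and "lp_norm p (\<lambda>j. x j + y j) \<le> lp_norm p x + lp_norm p y"
proof -
  have sx: "summable (\<lambda>j. norm (x j) powr p)" and sy: "summable (\<lambda>j. norm (y j) powr p)"
    using x y by (auto simp: lp_space_def)
  note m = minkowski_suminf[OF p norm_ge_zero norm_ge_zero sx sy]
  have le: "norm (x j + y j) powr p \<le> (norm (x j) + norm (y j)) powr p" for j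
    using p by (intro powr_mono2 norm_triangle_ineq) auto
  have s: "summable (\<lambda>j. norm (x j + y j) powr p)"
    by (rule summable_comparison_test'[OF m(1), of 0]) (use le in auto)
  then show "(\<lambda>j. x j + y j) \<in> lp_space p" using x y by (simp add: lp_space_def)
  have "(\<Sum>j. norm (x j + y j) powr p) powr (1 / p)
      \<le> (\<Sum>j. (norm (x j) + norm (y j)) powr p) powr (1 / p)"
    using p suminf_nonneg[OF s] suminf_le[OF le s m(1)] by (intro powr_mono2) auto
  then show "lp_norm p (\<lambda>j. x j + y j) \<le> lp_norm p x + lp_norm p y"
    using m(2) by (simp add: lp_norm_def)
qed

lemma lp_space_diff:
  fixes x y :: "nat \<Rightarrow> 'k::{real_normed_field, euclidean_space}"
  assumes "1 \<le> p" "x \<in> lp_space p" "y \<in> lp_space p"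
  shows "(\<lambda>j. x j - y j) \<in> lp_space p"
  using lp_space_add(1)[OF assms(1,2), of "\<lambda>j. - y j"] assms(3) by (simp add: lp_space_def)

lemma Metric_space_lp:
  assumes p: "1 \<le> p"
  shows "Metric_space (lp_space p :: (nat \<Rightarrow> 'k::{real_normed_field, euclidean_space}) set) (lp_dist p)"
proof
  fix x y z :: "nat \<Rightarrow> 'k"
  show "0 \<le> lp_dist p x y" by (simp add: lp_dist_def lp_norm_def)
  show "lp_dist p x y = lp_dist p y x" by (simp add: lp_dist_def lp_norm_def norm_minus_commute)
  assume x: "x \<in> lp_space p" and y: "y \<in> lp_space p"
  have s: "summable (\<lambda>j. norm (x j - y j) powr p)"
    using lp_space_diff[OF p x y] by (simp add: lp_space_def)
  show "lp_dist p x y = 0 \<longleftrightarrow> x = y"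
    using suminf_eq_zero_iff[OF s] by (auto simp: lp_dist_def lp_norm_def)
  assume z: "z \<in> lp_space p"
  show "lp_dist p x z \<le> lp_dist p x y + lp_dist p y z"
    using lp_space_add(2)[OF p lp_space_diff[OF p x y] lp_space_diff[OF p y z]]
    by (simp add: lp_dist_def)
qed

lemma topspace_lp_topology: "1 \<le> p \<Longrightarrow> topspace (lp_topology p) = lp_space p"
  by (simp add: lp_topology_def Metric_space.topspace_mtopology Metric_space_lp)


section \<open>Pseudo-shifts\<close>

definition pseudo_shift ::
  "(nat \<Rightarrow> nat) \<Rightarrow> (nat \<Rightarrow> 'k::{real_normed_field, euclidean_space}) \<Rightarrow> (nat \<Rightarrow> 'k) \<Rightarrow> nat \<Rightarrow> 'k" where
  "pseudo_shift f w x = (\<lambda>j. if j = 0 then 0 else w (f j) * x (f j))"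

lemma pseudo_shift_in_lp_space:
  fixes w x :: "nat \<Rightarrow> 'k::{real_normed_field, euclidean_space}"
  assumes p: "1 \<le> p" and f: "f \<in> {1..} \<rightarrow> {1..}" "strict_mono_on {1..} f"
    and w: "bounded (w ` {1..})" and x: "x \<in> lp_space p"
  shows "pseudo_shift f w x \<in> lp_space p"
proof -
  obtain C where C: "C > 0" "\<And>j. j \<ge> 1 \<Longrightarrow> norm (w j) \<le> C"
    using w unfolding bounded_pos by auto
  have s: "summable (\<lambda>j. norm (x j) powr p)" using x by (simp add: lp_space_def)
  define h where "h = f \<circ> Suc"
  have h: "inj h"
    using strict_mono_on_imp_inj_on[OF f(2)] by (auto simp: h_def inj_def inj_on_def)
  have s': "summable (\<lambda>j. C powr p * norm (x (h j)) powr p)"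
    using summable_reindex[OF s h] by (intro summable_mult) (auto simp: o_def)
  have "norm (pseudo_shift f w x (Suc j)) powr p \<le> C powr p * norm (x (h j)) powr p" for j
  proof -
    have "norm (w (f (Suc j))) \<le> C" using f(1) C(2) by (auto simp: Pi_iff)
    then have "norm (pseudo_shift f w x (Suc j)) \<le> C * norm (x (h j))"
      by (simp add: pseudo_shift_def h_def norm_mult mult_right_mono)
    then have "norm (pseudo_shift f w x (Suc j)) powr p \<le> (C * norm (x (h j))) powr p"
      using p by (intro powr_mono2) auto
    then show ?thesis using C(1) by (simp add: powr_mult)
  qed
  then have "summable (\<lambda>j. norm (pseudo_shift f w x (Suc j)) powr p)"
    by (intro summable_comparison_test'[OF s', of 0]) auto
  then show ?thesis
    using summable_Suc_iff[of "\<lambda>j. norm (pseudo_shift f w x j) powr p"]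
    by (simp add: lp_space_def pseudo_shift_def)
qed


section \<open>Upper Banach density and almost partition regularity\<close>

text \<open>The maximum below ranges over infinitely many windows, but only finitely many values occur.\<close>

definition upper_Banach_density :: "nat set \<Rightarrow> ereal" where
  "upper_Banach_density A =
     limsup (\<lambda>M. ereal (Max ((\<lambda>k. real (card (A \<inter> {k+1..k+M})) / real M) ` {1..})))"

lemma finite_window_densities:
  "finite ((\<lambda>k. real (card (A \<inter> {k+1..k+M})) / real M) ` {1::nat..})"
proof (rule finite_subset)
  have "card (A \<inter> {k+1..k+M}) \<le> M" for k
    using card_mono[of "{k+1..k+M}" "A \<inter> {k+1..k+M}"] by simp
  then show "(\<lambda>k. real (card (A \<inter> {k+1..k+M})) / real M) ` {1::nat..}
      \<subseteq> (\<lambda>c. real c / real M) ` {..M}"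
    by auto
qed simp

definition positive_upper_Banach :: "nat set set" where
  "positive_upper_Banach = {A. A \<subseteq> {1..} \<and> upper_Banach_density A > 0}"

definition almost_partition_regular ::
  "(nat \<Rightarrow> nat) \<Rightarrow> (nat \<Rightarrow> nat) \<Rightarrow> nat set set \<Rightarrow> bool" where
  "almost_partition_regular f1 f2 \<A> \<longleftrightarrow>
     (\<forall>l\<ge>1. \<forall>B\<in>\<A>. \<exists>A\<in>\<A>. A \<subseteq> B \<and>
        (\<forall>m\<in>A. \<forall>n\<in>A. m \<noteq> n \<longrightarrow>
           (\<forall>s\<in>{f1, f2}. \<forall>t\<in>{f1, f2}. (s ^^ m) ` {1..l} \<inter> (t ^^ n) ` {1..l} = {})))"


section \<open>Reiterative and disjoint hypercyclicity\<close>

definition reiteratively_hypercyclic :: "'x topology \<Rightarrow> ('x \<Rightarrow> 'x) \<Rightarrow> bool" where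
  "reiteratively_hypercyclic X T \<longleftrightarrow>
     (\<exists>x\<in>topspace X. \<forall>U. openin X U \<and> U \<noteq> {} \<longrightarrow>
        {n. n \<ge> 1 \<and> (T ^^ n) x \<in> U} \<in> positive_upper_Banach)"

definition disjoint_reiteratively_hypercyclic ::
  "'x topology \<Rightarrow> ('x \<Rightarrow> 'x) \<Rightarrow> ('x \<Rightarrow> 'x) \<Rightarrow> bool" where
  "disjoint_reiteratively_hypercyclic X T1 T2 \<longleftrightarrow>
     (\<exists>x\<in>topspace X. \<forall>V1 V2. openin X V1 \<and> V1 \<noteq> {} \<and> openin X V2 \<and> V2 \<noteq> {} \<longrightarrow>
        {n. n \<ge> 1 \<and> (T1 ^^ n) x \<in> V1 \<and> (T2 ^^ n) x \<in> V2} \<in> positive_upper_Banach)"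

definition disjoint_hypercyclic ::
  "'x topology \<Rightarrow> ('x \<Rightarrow> 'x) \<Rightarrow> ('x \<Rightarrow> 'x) \<Rightarrow> bool" where
  "disjoint_hypercyclic X T1 T2 \<longleftrightarrow>
     (\<exists>x\<in>topspace X. \<forall>V1 V2. openin X V1 \<and> V1 \<noteq> {} \<and> openin X V2 \<and> V2 \<noteq> {} \<longrightarrow>
        infinite {n. n \<ge> 1 \<and> (T1 ^^ n) x \<in> V1 \<and> (T2 ^^ n) x \<in> V2})"

end

theory Submission
  imports Defs
begin

text \<open>
  Write \<open>f\<close> for the common index map and \<open>W\<^sub>n(j) = w(f(j)) \<cdots> w(f\<^sup>n(j))\<close>, so that the \<open>j\<close>-th
  coordinate of \<open>T\<^sup>n x\<close> is \<open>W\<^sub>n(j) x(f\<^sup>n(j))\<close>; let \<open>R\<^sub>n(j)\<close> be the quotient of this product for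
  \<open>w2\<close> by the one for \<open>w1\<close>. Only the implication from right to left needs work. It rests on
  three facts.

  First, reiterative hypercyclicity of \<open>T\<close> forces \<open>\<Sum>\<^sub>q 1 / |W\<^sub>q(j)|\<^sup>p < \<infinity>\<close> for every \<open>j\<close>. If \<open>A\<close> is
  the set of times at which an orbit is close to \<open>e\<^sub>j\<close>, then looking at the time \<open>m \<in> A\<close> shows
  that \<open>a(q) = 1 / |W\<^sub>q(j)|\<^sup>p\<close> is summable along the return times \<open>q = n - m\<close>, \<open>n \<in> A\<close>, \<open>n > m\<close>,
  with a bound independent of \<open>m\<close>. As \<open>A\<close> has positive upper Banach density and \<open>a\<close> cannot
  drop faster than geometrically (the weights are bounded), this gives summability over all \<open>q\<close>:
  \<open>summable_if_summable_along_return_times\<close> and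
  \<open>reiteratively_hypercyclic_imp_summable\<close>.

  Second, disjoint hypercyclicity says that the vectors \<open>(R\<^sub>n(1), \<dots>, R\<^sub>n(L))\<close> accumulate
  everywhere. Since \<open>R\<^sub>k\<^sub>+\<^sub>n(j) = R\<^sub>k(j) R\<^sub>n(f\<^sup>k(j))\<close>, prescribing \<open>R\<^sub>n\<close> on a long initial segment of
  indices prescribes \<open>R\<^sub>n\<^sub>+\<^sub>k(j)\<close> for many \<open>k\<close> at once, as long as the indices \<open>f\<^sup>k(j)\<close> are
  distinct. So a single good time \<open>n\<close> yields a whole arithmetic progression of good times,
  of arbitrary length and fixed step: \<open>weight_ratio_along_progression\<close>.

  Third, the two facts combine. For each target pair \<open>(u, v)\<close> from a countable dense set of
  finitely supported vectors, and for arbitrarily long progressions of times \<open>n\<close> with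
  \<open>u(j) R\<^sub>n(j) \<approx> v(j)\<close>, put the entry \<open>u(j) / W\<^sub>n(j)\<close> (product for \<open>w1\<close>) at the coordinate
  \<open>f\<^sup>n(j)\<close>. At such a time \<open>n\<close> the first orbit shows \<open>u\<close> and the second one shows
  \<open>(u(j) R\<^sub>n(j))\<^sub>j \<approx> v\<close> on the support, while the entries made for later times \<open>n'\<close> contribute
  at most a tail of the series \<open>\<Sum>\<^sub>q 1 / |W\<^sub>q(j)|\<^sup>p\<close> with \<open>q = n' - n\<close>; these tails are made small
  by the choice of the step and of the gaps between progressions. A set that contains
  arbitrarily long progressions of one fixed step has positive upper Banach density:
  \<open>positive_upper_Banach_if_progressions\<close>, used in
  \<open>disjoint_reiteratively_hypercyclicI\<close>.
\<close>

section \<open>Sets of positive upper Banach density\<close>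

lemma positive_upper_BanachD:
  assumes "A \<in> positive_upper_Banach"
  obtains \<delta> :: real where "\<delta> > 0"
    and "\<And>M0. \<exists>M\<ge>M0. \<exists>k. \<delta> * real M \<le> real (card (A \<inter> {k+1..k+M}))"
proof -
  have "0 < upper_Banach_density A" using assms by (simp add: positive_upper_Banach_def)
  then obtain \<delta> :: real where \<delta>: "0 < \<delta>" "ereal \<delta> < upper_Banach_density A"
    using ereal_dense2[of 0 "upper_Banach_density A"] by auto
  have "\<exists>M\<ge>M0. \<exists>k. \<delta> * real M \<le> real (card (A \<inter> {k+1..k+M}))" for M0
  proof (rule ccontr)
    assume neg: "\<not> ?thesis"
    have "Max ((\<lambda>k. real (card (A \<inter> {k+1..k+M})) / real M) ` {1..}) \<le> \<delta>" if M: "M \<ge> max 1 M0" for M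
    proof -
      have "real (card (A \<inter> {k+1..k+M})) / real M \<le> \<delta>" for k
      proof -
        have "\<not> \<delta> * real M \<le> real (card (A \<inter> {k+1..k+M}))"
          using neg max.boundedE[OF M] by blast
        then have "real (card (A \<inter> {k+1..k+M})) \<le> \<delta> * real M" by linarith
        then show ?thesis using M by (simp add: divide_le_eq)
      qed
      then show ?thesis by (subst Max_le_iff[OF finite_window_densities]) auto
    qed
    then have "upper_Banach_density A \<le> ereal \<delta>"
      unfolding upper_Banach_density_def
      by (intro Limsup_bounded eventually_sequentiallyI[of "max 1 M0"]) simp
    then show False using \<delta>(2) by simp
  qed
  then show ?thesis using \<delta>(1) that by blast
qed

lemma positive_upper_Banach_imp_infinite:
  assumes "A \<in> positive_upper_Banach"
  shows "infinite A"
proof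
  assume fin: "finite A"
  obtain \<delta> :: real where \<delta>: "\<delta> > 0"
    and w: "\<And>M0. \<exists>M\<ge>M0. \<exists>k. \<delta> * real M \<le> real (card (A \<inter> {k+1..k+M}))"
    using positive_upper_BanachD[OF assms] by blast
  obtain M0 :: nat where M0: "real (card A) / \<delta> < real M0" using reals_Archimedean2 by blast
  obtain M k where M: "M \<ge> M0" and k: "\<delta> * real M \<le> real (card (A \<inter> {k+1..k+M}))"
    using w by blast
  have "real (card (A \<inter> {k+1..k+M})) \<le> real (card A)" using fin by (simp add: card_mono)
  moreover have "real (card A) < \<delta> * real M0" using M0 \<delta> by (simp add: field_simps)
  moreover have "\<delta> * real M0 \<le> \<delta> * real M" using M \<delta> by simp
  ultimately show False using k by linarith
qed

text \<open>A progression of step \<open>d\<close> and length \<open>L\<close> fills a fraction \<open>1 / d\<close> of a window of length \<open>d L\<close>.\<close>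

lemma positive_upper_Banach_if_progressions:
  assumes E: "E \<subseteq> {1..}" and d: "d \<ge> 1"
    and prog: "\<And>L. \<exists>N\<ge>1. \<forall>i\<in>{1..L}. N + d * i \<in> E"
  shows "E \<in> positive_upper_Banach"
proof -
  let ?mx = "\<lambda>M. Max ((\<lambda>k. real (card (E \<inter> {k+1..k+M})) / real M) ` {1..})"
  have big: "1 / real d \<le> ?mx (d * L)" if L: "L \<ge> 1" for L
  proof -
    obtain N where N: "N \<ge> 1" "\<forall>i\<in>{1..L}. N + d * i \<in> E" using prog by blast
    have "(\<lambda>i. N + d * i) ` {1..L} \<subseteq> E \<inter> {N+1..N+d*L}" using N(2) d by auto
    then have "card ((\<lambda>i. N + d * i) ` {1..L}) \<le> card (E \<inter> {N+1..N+d*L})"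
      by (intro card_mono) auto
    moreover have "card ((\<lambda>i. N + d * i) ` {1..L}) = L"
      using d by (subst card_image) (auto simp: inj_on_def)
    ultimately have "real L / real (d * L) \<le> real (card (E \<inter> {N+1..N+d*L})) / real (d * L)"
      by (intro divide_right_mono) auto
    also have "\<dots> \<le> ?mx (d * L)"
      using N(1) by (intro Max_ge[OF finite_window_densities]) auto
    finally show ?thesis using L by simp
  qed
  have "upper_Banach_density E \<ge> ereal (1 / real d)"
  proof (rule ccontr)
    assume "\<not> ?thesis"
    then have "limsup (\<lambda>M. ereal (?mx M)) < ereal (1 / real d)"
      by (simp add: upper_Banach_density_def not_le)
    then have "\<forall>\<^sub>F M in sequentially. ereal (?mx M) < ereal (1 / real d)"
      by (rule Limsup_lessD)
    then obtain M0 where M0: "\<And>M. M \<ge> M0 \<Longrightarrow> ?mx M < 1 / real d"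
      by (auto simp: eventually_sequentially)
    have "M0 \<le> d * (M0 + 1)" using d by (cases d) auto
    then show False using M0[of "d * (M0 + 1)"] big[of "M0 + 1"] by linarith
  qed
  moreover have "ereal 0 < ereal (1 / real d)" using d by simp
  ultimately have "0 < upper_Banach_density E" by (metis order_less_le_trans zero_ereal_def)
  then show ?thesis using E by (simp add: positive_upper_Banach_def)
qed

lemma sum_UN_le:
  fixes a :: "'x \<Rightarrow> real"
  assumes "finite H" "\<And>h. finite (P h)" "\<And>q. 0 \<le> a q"
  shows "sum a (\<Union>h\<in>H. P h) \<le> (\<Sum>h\<in>H. sum a (P h))"
proof -
  have "(\<Union>h\<in>H. P h) = snd ` (SIGMA h:H. P h)" by force
  then have "sum a (\<Union>h\<in>H. P h) \<le> sum (a \<circ> snd) (SIGMA h:H. P h)"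
    using assms by (simp only:) (intro sum_image_le finite_SigmaI; simp)
  also have "\<dots> = (\<Sum>h\<in>H. sum a (P h))"
    using assms by (subst sum.Sigma) (auto simp: case_prod_unfold)
  finally show ?thesis .
qed

text \<open>
  The first half of the passage from return times to all times: if \<open>\<Sum> a = \<infinity>\<close>, a set \<open>\<Gamma>\<close> of
  bounded \<open>a\<close>-mass is so thin that \<open>r\<close> shifts can be found all of whose mutual differences
  miss \<open>\<Gamma>\<close>. The point is that the range \<open>{..K}\<close> of the shifts is the same for all \<open>\<Gamma>\<close>.

  Given shifts \<open>H \<subseteq> {..K}\<close>, a new one is placed at \<open>- q\<close>, below all of them, which is
  admissible unless \<open>q\<close> lies in \<open>\<Gamma> - h\<close> for some \<open>h \<in> H\<close>. These sets have \<open>a\<close>-mass at most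
  \<open>C\<^sup>K\<close> times that of \<open>\<Gamma>\<close>, because \<open>a(q) \<le> C\<^sup>h a(q + h)\<close>; moving up instead of down would give
  no such bound. Hence they cannot cover an initial segment of large mass.
\<close>

lemma exists_shifts_avoiding_differences:
  fixes a :: "nat \<Rightarrow> real"
  assumes nn: "\<And>q. 0 \<le> a q" and C: "1 \<le> C" and step: "\<And>q. a q \<le> C * a (Suc q)"
    and div: "\<not> summable a"
  shows "\<exists>K. \<forall>\<Gamma>. finite \<Gamma> \<and> sum a \<Gamma> \<le> b \<longrightarrow>
    (\<exists>H. card H = r \<and> H \<subseteq> {..K} \<and> (\<forall>h\<in>H. \<forall>h'\<in>H. h < h' \<longrightarrow> h' - h \<notin> \<Gamma>))"
proof (induction r)
  case 0
  have "card ({}::nat set) = 0" by simp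
  then show ?case by blast
next
  case (Suc r)
  then obtain K where K: "\<forall>\<Gamma>. finite \<Gamma> \<and> sum a \<Gamma> \<le> b \<longrightarrow>
    (\<exists>H. card H = r \<and> H \<subseteq> {..K} \<and> (\<forall>h\<in>H. \<forall>h'\<in>H. h < h' \<longrightarrow> h' - h \<notin> \<Gamma>))" ..
  have steps: "a q \<le> C ^ h * a (q + h)" for q h
  proof (induction h)
    case (Suc h)
    have "C ^ h * a (q + h) \<le> C ^ h * (C * a (Suc (q + h)))"
      using step C by (intro mult_left_mono) auto
    then show ?case using Suc by (simp add: mult.assoc mult.left_commute)
  qed simp
  have "\<exists>Q. sum a {1..Q} > real (K + 1) * (C ^ K * b)"
  proof (rule ccontr)
    assume "\<not> ?thesis"
    then have bd: "sum a {1..Q} \<le> real (K + 1) * (C ^ K * b)" for Q by (simp add: not_less)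
    have "sum a {..<Q} \<le> a 0 + real (K + 1) * (C ^ K * b)" for Q
    proof -
      have "sum a {..<Q} \<le> sum a (insert 0 {1..Q})" by (rule sum_mono2) (auto simp: nn)
      then show ?thesis using bd[of Q] by simp
    qed
    then have "summable a" by (rule summableI_nonneg_bounded[OF nn])
    then show False using div by contradiction
  qed
  then obtain Q where Q: "sum a {1..Q} > real (K + 1) * (C ^ K * b)" by blast
  have "\<exists>H. card H = Suc r \<and> H \<subseteq> {..K+Q} \<and> (\<forall>h\<in>H. \<forall>h'\<in>H. h < h' \<longrightarrow> h' - h \<notin> \<Gamma>)"
    if \<Gamma>: "finite \<Gamma>" "sum a \<Gamma> \<le> b" for \<Gamma>
  proof -
    obtain H where H: "card H = r" "H \<subseteq> {..K}"
      "\<And>h h'. h \<in> H \<Longrightarrow> h' \<in> H \<Longrightarrow> h < h' \<Longrightarrow> h' - h \<notin> \<Gamma>"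
      using K[rule_format, OF conjI[OF \<Gamma>]] by blast
    have finH: "finite H" using H(2) finite_subset by blast
    have "\<exists>q\<in>{1..Q}. \<forall>h\<in>H. q + h \<notin> \<Gamma>"
    proof (rule ccontr)
      assume neg: "\<not> ?thesis"
      let ?P = "\<lambda>h. {q. q + h \<in> \<Gamma>}"
      have finP: "finite (?P h)" for h
        using \<Gamma>(1) by (rule finite_subset[rotated, OF finite_vimageI[of \<Gamma> "\<lambda>q. q + h"]])
          (auto simp: inj_def)
      have sumP: "sum a (?P h) \<le> C ^ K * sum a \<Gamma>" if h: "h \<in> H" for h
      proof -
        have "sum a (?P h) \<le> (\<Sum>q\<in>?P h. C ^ h * a (q + h))" by (intro sum_mono steps)
        also have "\<dots> = C ^ h * sum a ((\<lambda>q. q + h) ` ?P h)"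
          by (simp add: sum_distrib_left sum.reindex inj_on_def)
        also have "\<dots> \<le> C ^ h * sum a \<Gamma>"
          using C by (intro mult_left_mono sum_mono2) (auto simp: \<Gamma>(1) nn)
        also have "\<dots> \<le> C ^ K * sum a \<Gamma>"
          using C h H(2) by (intro mult_right_mono power_increasing sum_nonneg) (auto simp: nn)
        finally show ?thesis .
      qed
      have "sum a {1..Q} \<le> sum a (\<Union>h\<in>H. ?P h)"
        using neg finH finP by (intro sum_mono2) (auto simp: nn)
      also have "\<dots> \<le> (\<Sum>h\<in>H. sum a (?P h))"
        by (intro sum_UN_le finH finP nn)
      also have "\<dots> \<le> real (card H) * (C ^ K * sum a \<Gamma>)"
        by (rule sum_bounded_above) (use sumP in auto)
      also have "\<dots> \<le> real (K + 1) * (C ^ K * sum a \<Gamma>)"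
      proof (rule mult_right_mono)
        show "real (card H) \<le> real (K + 1)" using card_mono[OF _ H(2)] by simp
        show "0 \<le> C ^ K * sum a \<Gamma>" using C by (simp add: nn sum_nonneg)
      qed
      also have "\<dots> \<le> real (K + 1) * (C ^ K * b)"
        using C \<Gamma>(2) by (intro mult_left_mono) auto
      finally show False using Q by simp
    qed
    then obtain q where q: "q \<in> {1..Q}" "\<And>h. h \<in> H \<Longrightarrow> q + h \<notin> \<Gamma>" by blast
    \<comment> \<open>translated so that the new, lowest shift is \<open>0\<close>\<close>
    let ?H = "insert 0 ((+) q ` H)"
    have "card ?H = Suc r"
      using q(1) finH H(1) by (subst card_insert_disjoint) (auto simp: card_image)
    moreover have "?H \<subseteq> {..K+Q}" using q(1) H(2) by force
    moreover have "\<forall>h\<in>?H. \<forall>h'\<in>?H. h < h' \<longrightarrow> h' - h \<notin> \<Gamma>" using q H(3) by auto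
    ultimately show ?thesis by blast
  qed
  then show ?case by blast
qed

text \<open>A Bonferroni inequality for sets with small pairwise intersections.\<close>

lemma sum_card_le_card_UN:
  fixes X :: "'i \<Rightarrow> 'x set" and c :: real
  assumes "finite H" "\<And>h. h \<in> H \<Longrightarrow> finite (X h)" "0 \<le> c"
    and "\<And>h h'. h \<in> H \<Longrightarrow> h' \<in> H \<Longrightarrow> h \<noteq> h' \<Longrightarrow> real (card (X h \<inter> X h')) \<le> c"
  shows "(\<Sum>h\<in>H. real (card (X h))) \<le> real (card (\<Union>h\<in>H. X h)) + (real (card H))\<^sup>2 * c"
  using assms
proof (induction H rule: finite_induct)
  case (insert h H)
  let ?U = "\<Union>h\<in>H. X h"
  have finU: "finite ?U" using insert by auto
  have "card (X h \<inter> ?U) \<le> (\<Sum>h'\<in>H. card (X h \<inter> X h'))"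
    unfolding Int_UN_distrib by (rule card_UN_le[OF insert.hyps(1)])
  then have "real (card (X h \<inter> ?U)) \<le> (\<Sum>h'\<in>H. real (card (X h \<inter> X h')))"
    by (metis of_nat_mono of_nat_sum)
  also have "\<dots> \<le> real (card H) * c"
    using insert by (intro sum_bounded_above) auto
  finally have 1: "real (card (X h \<inter> ?U)) \<le> real (card H) * c" .
  have "card (X h) + card ?U = card (X h \<union> ?U) + card (X h \<inter> ?U)"
    using insert finU by (intro card_Un_Int) auto
  then have 2: "real (card (X h)) + real (card ?U) = real (card (X h \<union> ?U)) + real (card (X h \<inter> ?U))"
    by linarith
  have "(\<Sum>h\<in>H. real (card (X h))) \<le> real (card ?U) + (real (card H))\<^sup>2 * c"
    using insert by auto
  moreover have "(real (card H) + 1)\<^sup>2 * c = (real (card H))\<^sup>2 * c + 2 * (real (card H) * c) + c"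
    by (simp add: power2_eq_square algebra_simps)
  moreover have "0 \<le> real (card H) * c" using insert.prems by simp
  ultimately show ?case using insert 1 2 by (simp add: add.commute)
qed simp

text \<open>
  Suppose \<open>\<Sum> a = \<infinity>\<close>, and let \<open>S\<close> be the part of \<open>A\<close> in a long window of length \<open>M\<close> that \<open>A\<close>
  fills to a proportion \<open>\<delta>\<close>. Summing the hypothesis over the elements of \<open>S\<close> shows that the
  differences occurring at least \<open>c M\<close> times in \<open>S\<close> have total \<open>a\<close>-mass at most \<open>1 / c\<close>. So
  there are \<open>r\<close> shifts of bounded size with rare mutual differences, and the \<open>r\<close> translates of
  \<open>S\<close> by them are nearly disjoint. For \<open>r \<ge> 3 / \<delta>\<close> there is no room for them in a window of
  length at most \<open>2 M\<close>.
\<close>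

lemma summable_if_summable_along_return_times:
  fixes a :: "nat \<Rightarrow> real"
  assumes A: "A \<in> positive_upper_Banach"
    and nn: "\<And>q. 0 \<le> a q" and C: "1 \<le> C" and step: "\<And>q. a q \<le> C * a (Suc q)"
    and ret: "\<And>m F. m \<in> A \<Longrightarrow> finite F \<Longrightarrow> F \<subseteq> A \<inter> {m<..} \<Longrightarrow> (\<Sum>n\<in>F. a (n - m)) \<le> 1"
  shows "summable a"
proof (rule ccontr)
  assume div: "\<not> summable a"
  obtain \<delta> :: real where \<delta>: "\<delta> > 0"
    and win: "\<And>M0. \<exists>M\<ge>M0. \<exists>k. \<delta> * real M \<le> real (card (A \<inter> {k+1..k+M}))"
    using positive_upper_BanachD[OF A] by blast
  obtain r0 :: nat where r0: "3 / \<delta> < real r0" using reals_Archimedean2 by blast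
  define r where "r = max 1 r0"
  have "3 \<le> \<delta> * real r0" using r0 \<delta> by (simp add: field_simps)
  also have "\<dots> \<le> \<delta> * real r" using \<delta> by (simp add: r_def)
  finally have r: "3 \<le> \<delta> * real r" "r \<ge> 1" by (auto simp: r_def)
  define c where "c = 1 / (2 * (real r)\<^sup>2)"
  have c: "c > 0" "(real r)\<^sup>2 * c = 1 / 2" using r(2) by (auto simp: c_def)
  from exists_shifts_avoiding_differences[OF nn C step div, of "1 / c" r]
  obtain K where K: "\<forall>\<Gamma>. finite \<Gamma> \<and> sum a \<Gamma> \<le> 1 / c \<longrightarrow>
    (\<exists>H. card H = r \<and> H \<subseteq> {..K} \<and> (\<forall>h\<in>H. \<forall>h'\<in>H. h < h' \<longrightarrow> h' - h \<notin> \<Gamma>))" ..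
  obtain M k where M: "M \<ge> K + 1" and k: "\<delta> * real M \<le> real (card (A \<inter> {k+1..k+M}))"
    using win by blast
  define S where "S = A \<inter> {k+1..k+M}"
  have finS: "finite S" and cardS: "card S \<le> M"
    using card_mono[of "{k+1..k+M}" S] by (auto simp: S_def)
  \<comment> \<open>\<open>R q\<close> collects the occurrences of the difference \<open>q\<close> in \<open>S\<close>, and \<open>\<Gamma>\<close> the frequent differences.\<close>
  define R where "R q = {m\<in>S. m + q \<in> S}" for q
  define \<Gamma> where "\<Gamma> = {q\<in>{1..M}. c * real M \<le> real (card (R q))}"
  have finR: "finite (R q)" for q using finS by (simp add: R_def)
  have "c * real M * sum a \<Gamma> \<le> (\<Sum>q\<in>\<Gamma>. real (card (R q)) * a q)"
    unfolding sum_distrib_left by (intro sum_mono mult_right_mono) (auto simp: \<Gamma>_def nn)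
  also have "\<dots> \<le> (\<Sum>q\<in>{1..M}. real (card (R q)) * a q)"
    by (intro sum_mono2) (auto simp: \<Gamma>_def nn)
  also have "\<dots> = (\<Sum>q\<in>{1..M}. \<Sum>m\<in>S. if m + q \<in> S then a q else 0)"
    using finS by (intro sum.cong refl) (simp add: R_def flip: sum.inter_filter)
  also have "\<dots> = (\<Sum>m\<in>S. \<Sum>q\<in>{1..M}. if m + q \<in> S then a q else 0)"
    by (rule sum.swap)
  also have "\<dots> \<le> (\<Sum>m\<in>S. 1)"
  proof (rule sum_mono)
    fix m assume m: "m \<in> S"
    let ?F = "(\<lambda>q. m + q) ` {q\<in>{1..M}. m + q \<in> S}"
    have "(\<Sum>q\<in>{1..M}. if m + q \<in> S then a q else 0) = (\<Sum>q\<in>{q\<in>{1..M}. m + q \<in> S}. a q)"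
      by (subst sum.inter_filter) simp_all
    also have "\<dots> = (\<Sum>n\<in>?F. a (n - m))" by (simp add: sum.reindex)
    also have "\<dots> \<le> 1" using m by (intro ret) (auto simp: S_def)
    finally show "(\<Sum>q\<in>{1..M}. if m + q \<in> S then a q else 0) \<le> 1" .
  qed
  also have "\<dots> \<le> real M" using cardS by simp
  finally have "sum a \<Gamma> \<le> 1 / c" using M c by (simp add: field_simps)
  then have "finite \<Gamma> \<and> sum a \<Gamma> \<le> 1 / c" by (simp add: \<Gamma>_def)
  from K[rule_format, OF this] obtain H where H: "card H = r" "H \<subseteq> {..K}"
    "\<And>h h'. h \<in> H \<Longrightarrow> h' \<in> H \<Longrightarrow> h < h' \<Longrightarrow> h' - h \<notin> \<Gamma>"
    by blast
  have finH: "finite H" using H(2) finite_subset by blast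
  have small: "real (card ((+) h ` S \<inter> (+) h' ` S)) \<le> c * real M"
    if h: "h \<in> H" "h' \<in> H" "h < h'" for h h'
  proof -
    have "(+) h ` S \<inter> (+) h' ` S \<subseteq> (+) h' ` R (h' - h)"
    proof
      fix y assume "y \<in> (+) h ` S \<inter> (+) h' ` S"
      then obtain m m' where "m \<in> S" "m' \<in> S" "y = h + m" "y = h' + m'" by auto
      moreover from this have "m' + (h' - h) = m" using h(3) by simp
      ultimately show "y \<in> (+) h' ` R (h' - h)" by (auto simp: R_def)
    qed
    then have "card ((+) h ` S \<inter> (+) h' ` S) \<le> card ((+) h' ` R (h' - h))"
      using finR by (intro card_mono) auto
    also have "\<dots> \<le> card (R (h' - h))" by (intro card_image_le finR)
    finally have le: "card ((+) h ` S \<inter> (+) h' ` S) \<le> card (R (h' - h))" .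
    have "h' - h \<in> {1..M}" using h H(2) M by auto
    then have "real (card (R (h' - h))) < c * real M" using H(3)[OF h] by (auto simp: \<Gamma>_def)
    then show ?thesis using le by linarith
  qed
  have "(\<Sum>h\<in>H. real (card ((+) h ` S)))
    \<le> real (card (\<Union>h\<in>H. (+) h ` S)) + (real (card H))\<^sup>2 * (c * real M)"
  proof (rule sum_card_le_card_UN)
    fix h h' assume "h \<in> H" "h' \<in> H" "h \<noteq> h'"
    then show "real (card ((+) h ` S \<inter> (+) h' ` S)) \<le> c * real M"
      using small[of h h'] small[of h' h] by (cases "h < h'") (auto simp: Int_commute)
  qed (use finH finS c in auto)
  moreover have "(\<Sum>h\<in>H. real (card ((+) h ` S))) = real r * real (card S)"
    using H(1) by (simp add: card_image)
  moreover have "card (\<Union>h\<in>H. (+) h ` S) \<le> 2 * M"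
  proof -
    have "(\<Union>h\<in>H. (+) h ` S) \<subseteq> {k+1..k+(M+K)}" using H(2) by (force simp: S_def)
    then have "card (\<Union>h\<in>H. (+) h ` S) \<le> card {k+1..k+(M+K)}" by (intro card_mono) auto
    then show ?thesis using M by simp
  qed
  moreover have "(real (card H))\<^sup>2 * (c * real M) = real M / 2"
    using c(2) H(1) by (simp add: mult.assoc[symmetric])
  moreover have "3 * real M \<le> real r * real (card S)"
  proof -
    have "3 * real M \<le> (\<delta> * real r) * real M" using r(1) by (intro mult_right_mono) auto
    also have "\<dots> = real r * (\<delta> * real M)" by simp
    also have "\<dots> \<le> real r * real (card S)" using k by (intro mult_left_mono) (auto simp: S_def)
    finally show ?thesis .
  qed
  ultimately show False using M by linarith
qed


section \<open>Neighbourhoods in sequence spaces\<close>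

lemma lp_spaceI_finite_sums:
  fixes z :: "nat \<Rightarrow> 'k::{real_normed_field, euclidean_space}"
  assumes p: "1 \<le> p" and z0: "z 0 = 0"
    and bd: "\<And>F. finite F \<Longrightarrow> F \<subseteq> {1..} \<Longrightarrow> (\<Sum>i\<in>F. norm (z i) powr p) \<le> c"
  shows "z \<in> lp_space p" "lp_norm p z \<le> c powr (1 / p)"
proof -
  have bd': "(\<Sum>i<n. norm (z i) powr p) \<le> c" for n
  proof -
    have "(\<Sum>i<n. norm (z i) powr p) = (\<Sum>i\<in>{..<n} - {0}. norm (z i) powr p)"
      using z0 by (intro sum.mono_neutral_right) auto
    also have "\<dots> \<le> c" by (rule bd) auto
    finally show ?thesis .
  qed
  have s: "summable (\<lambda>i. norm (z i) powr p)"
    by (rule summableI_nonneg_bounded[OF _ bd']) auto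
  then show "z \<in> lp_space p" using z0 by (simp add: lp_space_def)
  have "(\<Sum>i. norm (z i) powr p) \<le> c" by (rule suminf_le_const[OF s bd'])
  then show "lp_norm p z \<le> c powr (1 / p)"
    using p suminf_nonneg[OF s] unfolding lp_norm_def by (intro powr_mono2) auto
qed

lemma finite_sum_le_lp_norm:
  fixes z :: "nat \<Rightarrow> 'k::{real_normed_field, euclidean_space}"
  assumes p: "1 \<le> p" and z: "z \<in> lp_space p" and F: "finite F"
  shows "(\<Sum>i\<in>F. norm (z i) powr p) \<le> lp_norm p z powr p"
proof -
  have s: "summable (\<lambda>i. norm (z i) powr p)" using z by (simp add: lp_space_def)
  have "(\<Sum>i\<in>F. norm (z i) powr p) \<le> (\<Sum>i. norm (z i) powr p)"
    by (rule sum_le_suminf[OF s F]) auto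
  also have "\<dots> = lp_norm p z powr p"
    using p suminf_nonneg[OF s] by (simp add: lp_norm_def powr_powr)
  finally show ?thesis .
qed

definition lp_ball ::
  "real \<Rightarrow> (nat \<Rightarrow> 'k::{real_normed_field, euclidean_space}) \<Rightarrow> real \<Rightarrow> (nat \<Rightarrow> 'k) set" where
  "lp_ball p y r = {x \<in> lp_space p. lp_dist p x y < r}"

lemma lp_dist_commute: "lp_dist p x y = lp_dist p y x"
  by (simp add: lp_dist_def lp_norm_def norm_minus_commute)

lemma mball_eq_lp_ball:
  assumes "1 \<le> p" "y \<in> lp_space p"
  shows "Metric_space.mball (lp_space p) (lp_dist p) y r = lp_ball p y r"
proof -
  interpret Metric_space "lp_space p" "lp_dist p" by (rule Metric_space_lp[OF assms(1)])
  show ?thesis using assms(2) by (auto simp: mball_def lp_ball_def lp_dist_commute)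
qed

lemma openin_lp_ball:
  assumes "1 \<le> p" "y \<in> lp_space p"
  shows "openin (lp_topology p) (lp_ball p y r)"
proof -
  interpret Metric_space "lp_space p" "lp_dist p" by (rule Metric_space_lp[OF assms(1)])
  show ?thesis using openin_mball[of y r] mball_eq_lp_ball[OF assms]
    by (simp add: lp_topology_def)
qed

lemma centre_in_lp_ball:
  assumes "1 \<le> p" "y \<in> lp_space p" "0 < r"
  shows "y \<in> lp_ball p y r"
  using assms by (simp add: lp_ball_def lp_dist_def lp_norm_def)

lemma openin_lp_topology_ball:
  assumes "1 \<le> p" "openin (lp_topology p) U" "y \<in> U"
  obtains r where "r > 0" "lp_ball p y r \<subseteq> U" "y \<in> lp_space p"
proof -
  interpret Metric_space "lp_space p" "lp_dist p" by (rule Metric_space_lp[OF assms(1)])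
  have "U \<subseteq> lp_space p" and "\<exists>r>0. mball y r \<subseteq> U"
    using assms(2,3) by (auto simp: lp_topology_def openin_mtopology)
  then show ?thesis using that mball_eq_lp_ball[OF assms(1)] assms(3) by (metis subsetD)
qed

lemma lp_ball_coord:
  assumes p: "1 \<le> p" and x: "x \<in> lp_ball p y r" and y: "y \<in> lp_space p"
  shows "norm (x i - y i) < r"
proof -
  have z: "(\<lambda>j. x j - y j) \<in> lp_space p"
    using x by (intro lp_space_diff[OF p _ y]) (simp add: lp_ball_def)
  have "norm (x i - y i) powr p \<le> lp_norm p (\<lambda>j. x j - y j) powr p"
    using finite_sum_le_lp_norm[OF p z, of "{i}"] by simp
  then have "norm (x i - y i) \<le> lp_norm p (\<lambda>j. x j - y j)"
    using p powr_less_mono2[of p "lp_norm p (\<lambda>j. x j - y j)" "norm (x i - y i)"]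
    by (fastforce simp: lp_norm_def)
  then show ?thesis using x by (simp add: lp_ball_def lp_dist_def)
qed

lemma finite_support_in_lp_space:
  fixes z :: "nat \<Rightarrow> 'k::{real_normed_field, euclidean_space}"
  assumes "z 0 = 0" "finite {i. z i \<noteq> 0}"
  shows "z \<in> lp_space p"
  using assms unfolding lp_space_def
  by (auto intro!: summable_finite[of "{i. z i \<noteq> 0}"])

text \<open>
  The targets of the construction are encoded by lists because the lists over a countable set
  form a countable set. The shift by one keeps coordinate \<open>0\<close> empty.
\<close>

definition vec_of_list :: "'k::zero list \<Rightarrow> nat \<Rightarrow> 'k" where
  "vec_of_list us i = (if i \<in> {1..length us} then us ! (i - 1) else 0)"

lemma vec_of_list_in_lp_space:
  "vec_of_list us \<in> lp_space p" for us :: "'k::{real_normed_field, euclidean_space} list"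
proof (rule finite_support_in_lp_space)
  have "{i. vec_of_list us i \<noteq> 0} \<subseteq> {1..length us}" by (auto simp: vec_of_list_def split: if_splits)
  then show "finite {i. vec_of_list us i \<noteq> 0}" using finite_subset by blast
qed (simp add: vec_of_list_def)

text \<open>
  Density of the finitely supported vectors with entries in \<open>D\<close>. All sufficiently large lengths
  are available, so that two open sets can be met by vectors of the same length.
\<close>

lemma openin_lp_topology_contains_vec_of_list:
  fixes U :: "(nat \<Rightarrow> 'k::{real_normed_field, euclidean_space}) set"
  assumes p: "1 \<le> p" and U: "openin (lp_topology p) U" "U \<noteq> {}"
    and D: "\<And>X. open X \<Longrightarrow> X \<noteq> {} \<Longrightarrow> \<exists>d\<in>D. d \<in> X"
  obtains l0 where "\<And>l. l \<ge> l0 \<Longrightarrow> \<exists>us. length us = l \<and> set us \<subseteq> D \<and> vec_of_list us \<in> U"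
proof -
  obtain y where "y \<in> U" using U(2) by blast
  then obtain r where r: "r > 0" "lp_ball p y r \<subseteq> U" and y: "y \<in> lp_space p"
    using openin_lp_topology_ball[OF p U(1)] by metis
  define c where "c = (r / 2) powr p / 2"
  have c: "c > 0" using r(1) by (simp add: c_def)
  have sy: "summable (\<lambda>i. norm (y i) powr p)" using y by (simp add: lp_space_def)
  obtain l0 where l0: "\<And>m n. m \<ge> l0 \<Longrightarrow> norm (\<Sum>i=m..n. norm (y i) powr p) < c"
    using summable_partial_sum_bound[OF sy c] by blast
  have "\<exists>us. length us = l \<and> set us \<subseteq> D \<and> vec_of_list us \<in> U" if l: "l \<ge> l0" for l
  proof -
    define \<epsilon> where "\<epsilon> = (c / (real l + 1)) powr (1 / p)"
    have \<epsilon>: "\<epsilon> > 0" using c by (simp add: \<epsilon>_def)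
    have \<epsilon>p: "\<epsilon> powr p = c / (real l + 1)" using c p by (simp add: \<epsilon>_def powr_powr)
    have "\<exists>d\<in>D. norm (d - y i) < \<epsilon>" for i
      using D[of "ball (y i) \<epsilon>"] \<epsilon> by (auto simp: dist_norm norm_minus_commute)
    then obtain d where d: "\<And>i. d i \<in> D" "\<And>i. norm (d i - y i) < \<epsilon>" by metis
    define us where "us = map (\<lambda>i. d (Suc i)) [0..<l]"
    have us: "vec_of_list us i = (if i \<in> {1..l} then d i else 0)" for i
      by (auto simp: vec_of_list_def us_def)
    have le: "(\<Sum>i\<in>F. norm (vec_of_list us i - y i) powr p) \<le> (r / 2) powr p"
      if F: "finite F" "F \<subseteq> {1..}" for F
    proof -
      let ?g = "\<lambda>i. norm (vec_of_list us i - y i) powr p"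
      have "sum ?g F \<le> sum ?g ({1..l} \<union> {Suc l..Max (insert 0 F)})"
        using F by (intro sum_mono2) (auto simp: not_le Suc_le_eq)
      also have "\<dots> = sum ?g {1..l} + sum ?g {Suc l..Max (insert 0 F)}"
        by (intro sum.union_disjoint) auto
      also have "sum ?g {1..l} \<le> (\<Sum>i\<in>{1..l}. c / (real l + 1))"
      proof (rule sum_mono)
        fix i assume "i \<in> {1..l}"
        then have "?g i \<le> \<epsilon> powr p" using d(2)[of i] p us by (intro powr_mono2) auto
        then show "?g i \<le> c / (real l + 1)" using \<epsilon>p by simp
      qed
      also have "\<dots> \<le> c" using c by (simp add: field_simps)
      also have "sum ?g {Suc l..Max (insert 0 F)} = (\<Sum>i=Suc l..Max (insert 0 F). norm (y i) powr p)"
        by (intro sum.cong) (auto simp: us)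
      also have "\<dots> \<le> c" using l0[of "Suc l" "Max (insert 0 F)"] l by auto
      finally show ?thesis by (simp add: c_def)
    qed
    have y0: "vec_of_list us 0 - y 0 = 0" using y by (simp add: us lp_space_def)
    have "lp_dist p (vec_of_list us) y \<le> ((r / 2) powr p) powr (1 / p)"
      unfolding lp_dist_def by (rule lp_spaceI_finite_sums(2)[OF p y0 le])
    also have "\<dots> < r" using p r(1) by (simp add: powr_powr)
    finally have "vec_of_list us \<in> U"
      using r(2) vec_of_list_in_lp_space[of us p] by (auto simp: lp_ball_def)
    moreover have "set us \<subseteq> D" using d(1) by (auto simp: us_def)
    moreover have "length us = l" by (simp add: us_def)
    ultimately show ?thesis by blast
  qed
  then show ?thesis using that by blast
qed


section \<open>Orbits of pseudo-shifts\<close>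

definition weight_prod :: "(nat \<Rightarrow> nat) \<Rightarrow> (nat \<Rightarrow> 'k::comm_monoid_mult) \<Rightarrow> nat \<Rightarrow> nat \<Rightarrow> 'k" where
  "weight_prod f w n j = (\<Prod>i<n. w ((f ^^ Suc i) j))"

lemma weight_prod_add:
  "weight_prod f w (m + n) j = weight_prod f w m j * weight_prod f w n ((f ^^ m) j)"
proof (induction n)
  case (Suc n)
  have "(f ^^ Suc n) ((f ^^ m) j) = (f ^^ Suc (m + n)) j"
    by (metis add.commute add_Suc funpow_add o_apply)
  then show ?case using Suc by (simp add: weight_prod_def mult.assoc del: funpow.simps)
qed (simp add: weight_prod_def)

text \<open>
  Such a map moves every index up, so that each orbit \<open>j, f(j), f(f(j)), \<dots>\<close> is strictly increasing.
\<close>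

locale index_map =
  fixes f :: "nat \<Rightarrow> nat"
  assumes maps: "f \<in> {1..} \<rightarrow> {1..}"
    and mono: "strict_mono_on {1..} f"
    and one: "f 1 > 1"
begin

lemma less_map: "j \<ge> 1 \<Longrightarrow> j < f j"
proof (induction j rule: nat_induct_at_least)
  case (Suc n)
  have "f n < f (Suc n)" using strict_mono_onD[OF mono, of n "Suc n"] Suc by auto
  then show ?case using Suc by simp
qed (use one in simp)

lemma funpow_ge: "j \<ge> 1 \<Longrightarrow> j + n \<le> (f ^^ n) j"
proof (induction n)
  case (Suc n)
  then have "(f ^^ n) j < f ((f ^^ n) j)" by (intro less_map) auto
  then show ?case using Suc by simp
qed simp

lemma funpow_ge_1: "j \<ge> 1 \<Longrightarrow> (f ^^ n) j \<ge> 1"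
  using funpow_ge[of j n] by linarith

lemma funpow_inj: "j \<ge> 1 \<Longrightarrow> k \<ge> 1 \<Longrightarrow> (f ^^ n) j = (f ^^ n) k \<Longrightarrow> j = k"
proof (induction n)
  case (Suc n)
  have "inj_on f {1..}" by (rule strict_mono_on_imp_inj_on[OF mono])
  then have "(f ^^ n) j = (f ^^ n) k"
    using Suc.prems funpow_ge_1[of j n] funpow_ge_1[of k n] by (auto simp: inj_on_def)
  then show ?case using Suc by blast
qed simp

lemma funpow_eq_imp:
  assumes "i \<ge> 1" "j \<ge> 1" "m \<le> n" "(f ^^ m) i = (f ^^ n) j"
  shows "i = (f ^^ (n - m)) j"
proof -
  have "(f ^^ n) j = (f ^^ m) ((f ^^ (n - m)) j)" using assms(3) by (metis funpow_add le_add_diff_inverse o_apply)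
  then show ?thesis using funpow_inj[of i "(f ^^ (n - m)) j" m] assms funpow_ge_1[of j] by auto
qed

text \<open>
  Since \<open>f\<close> moves every index up, the sets \<open>f\<^sup>m {1..l}\<close> and \<open>f\<^sup>n {1..l}\<close> are disjoint as
  soon as \<open>m\<close> and \<open>n\<close> differ by at least \<open>l\<close>.
\<close>

lemma funpow_neq_if_far:
  assumes "i \<in> {1..l}" "j \<ge> 1" "m + l \<le> n"
  shows "(f ^^ m) i \<noteq> (f ^^ n) j"
proof
  assume "(f ^^ m) i = (f ^^ n) j"
  then have "i = (f ^^ (n - m)) j" using assms by (intro funpow_eq_imp) auto
  then show False using funpow_ge[of j "n - m"] assms by auto
qed

lemma pseudo_shift_funpow:
  assumes "j \<ge> 1"
  shows "(pseudo_shift f w ^^ n) x j = weight_prod f w n j * x ((f ^^ n) j)"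
  using assms
proof (induction n arbitrary: j)
  case (Suc n)
  have "f j \<ge> 1" using less_map[OF Suc.prems] by simp
  have "(pseudo_shift f w ^^ Suc n) x j = w (f j) * (pseudo_shift f w ^^ n) x (f j)"
    using Suc.prems by (simp add: pseudo_shift_def)
  also have "\<dots> = weight_prod f w (1 + n) j * x ((f ^^ Suc n) j)"
    unfolding weight_prod_add Suc.IH[OF \<open>f j \<ge> 1\<close>]
    by (simp add: weight_prod_def funpow_swap1)
  finally show ?case by simp
qed (simp add: weight_prod_def)

lemma pseudo_shift_funpow_0: "x 0 = 0 \<Longrightarrow> (pseudo_shift f w ^^ n) x 0 = 0"
  by (cases n) (auto simp: pseudo_shift_def)

lemma pseudo_shift_funpow_in_lp_space:
  assumes "1 \<le> p" "bounded (w ` {1..})" "x \<in> lp_space p"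
  shows "(pseudo_shift f w ^^ n) x \<in> lp_space p"
  by (induction n) (use pseudo_shift_in_lp_space[OF assms(1) maps mono assms(2)] assms(3) in auto)

text \<open>
  A vector whose orbit is close to \<open>e\<^sub>j\<close> at the times in \<open>A\<close> has an \<open>f\<^sup>n(j)\<close>-th entry of about
  \<open>1 / W\<^sub>n(j)\<close> for \<open>n \<in> A\<close>. At an earlier time \<open>m \<in> A\<close> the orbit shows this entry at the coordinate
  \<open>f\<^bsup>n-m\<^esup>(j) \<noteq> j\<close>, with value about \<open>1 / W\<^bsub>n-m\<^esub>(j)\<close>, and there \<open>e\<^sub>j\<close> vanishes. So the \<open>p\<close>-th
  powers of these values, for all \<open>n \<in> A\<close> with \<open>n > m\<close>, have a sum bounded independently of \<open>m\<close>.
\<close>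

lemma reiteratively_hypercyclic_imp_summable:
  fixes w :: "nat \<Rightarrow> 'k::{real_normed_field, euclidean_space}"
  assumes p: "1 \<le> p" and w: "bounded (w ` {1..})"
    and hc: "reiteratively_hypercyclic (lp_topology p) (pseudo_shift f w)" and j: "j \<ge> 1"
  shows "weight_prod f w n j \<noteq> 0"
    and "summable (\<lambda>q. norm (weight_prod f w q j) powr (- p))"
proof -
  let ?T = "pseudo_shift f w" and ?W = "weight_prod f w"
  obtain x where x: "x \<in> lp_space p"
    and vis: "\<And>U. openin (lp_topology p) U \<Longrightarrow> U \<noteq> {} \<Longrightarrow>
        {n. n \<ge> 1 \<and> (?T ^^ n) x \<in> U} \<in> positive_upper_Banach"
    using hc by (auto simp: reiteratively_hypercyclic_def topspace_lp_topology[OF p])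
  define e where "e i = (if i = j then 1 else 0 :: 'k)" for i
  have e: "e \<in> lp_space p"
  proof (rule finite_support_in_lp_space)
    have "{i. e i \<noteq> 0} \<subseteq> {j}" by (auto simp: e_def)
    then show "finite {i. e i \<noteq> 0}" using finite_subset by blast
  qed (use j in \<open>simp add: e_def\<close>)
  \<comment> \<open>With radius \<open>1/2\<close> the constants cancel: the entries are at least \<open>1/2\<close> where \<open>e\<close> is \<open>1\<close>, and
    the sum of the \<open>p\<close>-th powers of the others is at most \<open>(1/2)\<^sup>p\<close>.\<close>
  define A where "A = {n. n \<ge> 1 \<and> (?T ^^ n) x \<in> lp_ball p e (1/2)}"
  have A: "A \<in> positive_upper_Banach"
    unfolding A_def using centre_in_lp_ball[OF p e, of "1/2"]
    by (intro vis openin_lp_ball[OF p e]) auto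
  have near: "norm (?W n i * x ((f ^^ n) i) - e i) < 1/2" if "n \<in> A" "i \<ge> 1" for n i
    using lp_ball_coord[OF p _ e, of "(?T ^^ n) x" "1/2" i] that
    by (simp add: A_def pseudo_shift_funpow)
  have large: "norm (?W n j * x ((f ^^ n) j)) \<ge> 1/2" if "n \<in> A" for n
  proof -
    have "norm (1::'k) \<le> norm (?W n j * x ((f ^^ n) j)) + norm (?W n j * x ((f ^^ n) j) - 1)"
      using norm_triangle_ineq4[of "?W n j * x ((f ^^ n) j)" "?W n j * x ((f ^^ n) j) - 1"] by simp
    then show ?thesis using near[OF that j] by (simp add: e_def)
  qed
  have nz: "?W n j \<noteq> 0" for n
  proof -
    obtain n' where n': "n' \<in> A" "n' > n"
      using positive_upper_Banach_imp_infinite[OF A] by (meson infinite_nat_iff_unbounded)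
    have "?W n' j = ?W n j * ?W (n' - n) ((f ^^ n) j)"
      using weight_prod_add[of f w n "n' - n" j] n'(2) by simp
    then show ?thesis using large[OF n'(1)] by auto
  qed
  then show "weight_prod f w n j \<noteq> 0" .
  obtain C0 where C0: "C0 > 0" "\<And>i. i \<ge> 1 \<Longrightarrow> norm (w i) \<le> C0"
    using w unfolding bounded_pos by auto
  define C where "C = max 1 C0"
  define a where "a q = norm (?W q j) powr (- p)" for q
  show "summable (\<lambda>q. norm (weight_prod f w q j) powr (- p))"
    unfolding a_def[symmetric]
  proof (rule summable_if_summable_along_return_times[OF A, where C = "C powr p"])
    show "0 \<le> a q" for q by (simp add: a_def)
    show "1 \<le> C powr p" using p by (intro ge_one_powr_ge_zero) (auto simp: C_def)
    show "a q \<le> C powr p * a (Suc q)" for q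
    proof -
      have "norm (?W (Suc q) j) = norm (?W q j) * norm (w ((f ^^ Suc q) j))"
        by (simp add: weight_prod_def norm_mult)
      also have "\<dots> \<le> norm (?W q j) * C"
        using C0(2)[OF funpow_ge_1[OF j], of "Suc q"] by (intro mult_left_mono) (auto simp: C_def)
      finally have le: "norm (?W (Suc q) j) \<le> norm (?W q j) * C" .
      have "(norm (?W q j) * C) powr (- p) \<le> norm (?W (Suc q) j) powr (- p)"
        using p nz[of "Suc q"] le by (intro powr_mono2') auto
      then have "a q * C powr (- p) \<le> a (Suc q)"
        by (simp add: a_def powr_mult C_def)
      then show ?thesis by (simp add: powr_minus divide_simps C_def mult.commute split: if_splits)
    qed
  next
    fix m F assume m: "m \<in> A" and F: "finite F" "F \<subseteq> A \<inter> {m<..}"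
    let ?g = "\<lambda>n. (f ^^ (n - m)) j"
    have inj: "inj_on ?g F"
    proof (rule inj_onI)
      fix n n' assume n: "n \<in> F" "n' \<in> F" "?g n = ?g n'"
      have "a = b" if "(f ^^ a) j = (f ^^ b) j" "a \<le> b" for a b
        using funpow_eq_imp[OF j j that(2,1)] funpow_ge[OF j, of "b - a"] that(2) by simp
      then have "n - m = n' - m" using n(3) by (metis nle_le)
      then show "n = n'" using n(1,2) F(2) by (metis IntE add_diff_inverse_nat greaterThan_iff not_less_iff_gr_or_eq subsetD)
    qed
    have z: "(\<lambda>i. (?T ^^ m) x i - e i) \<in> lp_space p"
      by (intro lp_space_diff[OF p _ e] pseudo_shift_funpow_in_lp_space[OF p w x])
    have entry: "(1/2) powr p * a (n - m) \<le> norm ((?T ^^ m) x (?g n) - e (?g n)) powr p"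
      if n: "n \<in> F" for n
    proof -
      have nm: "n \<in> A" "m < n" using n F by auto
      have "?g n \<noteq> j" using funpow_ge[OF j, of "n - m"] nm(2) by auto
      then have eq: "(?T ^^ m) x (?g n) - e (?g n) = ?W m (?g n) * x ((f ^^ m) (?g n))"
        using pseudo_shift_funpow[OF funpow_ge_1[OF j]] by (simp add: e_def)
      have "(f ^^ m) (?g n) = (f ^^ n) j"
        using nm(2) by (metis funpow_add less_imp_le_nat le_add_diff_inverse o_apply)
      moreover have "?W n j = ?W (n - m) j * ?W m (?g n)"
        using weight_prod_add[of f w "n - m" m j] nm(2) by simp
      ultimately have "?W m (?g n) * x ((f ^^ m) (?g n)) = ?W n j * x ((f ^^ n) j) / ?W (n - m) j"
        using nz[of "n - m"] by (simp add: field_simps)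
      then have "norm ((?T ^^ m) x (?g n) - e (?g n)) powr p
          = norm (?W n j * x ((f ^^ n) j)) powr p * a (n - m)"
        unfolding eq by (simp add: norm_divide powr_divide a_def powr_minus_divide)
      moreover have "(1/2) powr p \<le> norm (?W n j * x ((f ^^ n) j)) powr p"
        using p large[OF nm(1)] by (intro powr_mono2) auto
      ultimately show ?thesis by (simp add: mult_right_mono a_def)
    qed
    have "(1/2) powr p * (\<Sum>n\<in>F. a (n - m)) \<le> (\<Sum>n\<in>F. norm ((?T ^^ m) x (?g n) - e (?g n)) powr p)"
      unfolding sum_distrib_left by (rule sum_mono[OF entry])
    also have "\<dots> = (\<Sum>i\<in>?g ` F. norm ((?T ^^ m) x i - e i) powr p)"
      by (simp add: sum.reindex[OF inj])
    also have "\<dots> \<le> lp_norm p (\<lambda>i. (?T ^^ m) x i - e i) powr p"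
      by (rule finite_sum_le_lp_norm[OF p z]) (use F in auto)
    also have "\<dots> \<le> (1/2) powr p"
      using m p by (intro powr_mono2) (auto simp: A_def lp_ball_def lp_dist_def lp_norm_def)
    finally show "(\<Sum>n\<in>F. a (n - m)) \<le> 1"
      by (simp add: mult_le_cancel_left2)
  qed
qed

end


section \<open>Ratios of weight products\<close>

lemma norm_mult_ratio_less:
  fixes c v A B :: "'k::real_normed_field"
  assumes c: "c \<noteq> 0" and A: "norm (A - c) < \<eta>" and B: "norm (B - v) < \<eta>"
    and \<eta>: "\<eta> \<le> norm c / 2" "\<eta> \<le> \<epsilon> * norm c / (2 * (norm c + norm v))"
  shows "norm (c * (B / A) - v) < \<epsilon>"
proof -
  have "norm c \<le> norm A + norm (A - c)" using norm_triangle_ineq4[of A "A - c"] by simp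
  then have A2: "norm A > norm c / 2" using A \<eta>(1) by linarith
  then have A0: "norm A > 0" using c by (smt (verit) norm_ge_zero zero_less_norm_iff field_sum_of_halves)
  have cv: "norm c + norm v > 0" using c by (simp add: add_pos_nonneg)
  have \<eta>0: "\<eta> > 0" using A norm_ge_zero[of "A - c"] by linarith
  have \<epsilon>0: "\<epsilon> > 0"
  proof (rule ccontr)
    assume "\<not> ?thesis"
    then have "\<epsilon> * norm c / (2 * (norm c + norm v)) \<le> 0"
      using cv by (intro divide_nonpos_pos mult_nonpos_nonneg) auto
    then show False using \<eta>0 \<eta>(2) by linarith
  qed
  have "norm (c * (B - v) - v * (A - c)) \<le> norm c * norm (B - v) + norm v * norm (A - c)"
    using norm_triangle_ineq4[of "c * (B - v)" "v * (A - c)"] by (simp add: norm_mult)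
  also have "\<dots> \<le> norm c * \<eta> + norm v * \<eta>"
    using A B by (intro add_mono mult_left_mono) auto
  also have "\<dots> = (norm c + norm v) * \<eta>" by (simp add: algebra_simps)
  also have "\<dots> \<le> \<epsilon> * (norm c / 2)"
    using \<eta>(2) cv by (simp add: field_simps)
  also have "\<dots> < \<epsilon> * norm A" using A2 \<epsilon>0 by (intro mult_strict_left_mono)
  finally have "norm (c * (B - v) - v * (A - c)) / norm A < \<epsilon>"
    using A0 by (simp add: divide_less_eq)
  moreover have "c * (B / A) - v = (c * (B - v) - v * (A - c)) / A"
    using A0 by (simp add: field_simps)
  ultimately show ?thesis by (simp add: norm_divide)
qed

context index_map
begin

text \<open>
  If the two orbits of \<open>x\<close> are close to \<open>c\<close> and \<open>v\<close> at time \<open>n\<close>, then dividing the \<open>i\<close>-th coordinates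
  \<open>W2\<^sub>n(i) x(f\<^sup>n(i)) \<approx> v(i)\<close> and \<open>W1\<^sub>n(i) x(f\<^sup>n(i)) \<approx> c(i)\<close> eliminates \<open>x\<close>.
\<close>

lemma disjoint_hypercyclic_imp_weight_ratio:
  fixes w1 w2 c v :: "nat \<Rightarrow> 'k::{real_normed_field, euclidean_space}"
  assumes p: "1 \<le> p"
    and dh: "disjoint_hypercyclic (lp_topology p) (pseudo_shift f w1) (pseudo_shift f w2)"
    and c: "\<And>i. i \<in> {1..L} \<Longrightarrow> c i \<noteq> 0" and \<epsilon>: "0 < \<epsilon>"
  shows "\<exists>n\<ge>N0. \<forall>i\<in>{1..L}. norm (c i * (weight_prod f w2 n i / weight_prod f w1 n i) - v i) < \<epsilon>"
proof -
  define h where "h i = min (norm (c i) / 2) (\<epsilon> * norm (c i) / (2 * (norm (c i) + norm (v i))))" for i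
  have h: "h i > 0" if "i \<in> {1..L}" for i
    using c[OF that] \<epsilon> by (auto simp: h_def intro!: divide_pos_pos mult_pos_pos add_pos_nonneg)
  define \<eta> where "\<eta> = Min (insert 1 (h ` {1..L}))"
  have \<eta>: "\<eta> > 0" using h by (auto simp: \<eta>_def)
  have \<eta>h: "\<eta> \<le> h i" if "i \<in> {1..L}" for i
    unfolding \<eta>_def by (intro Min_le) (use that in auto)
  define cL where "cL i = (if i \<in> {1..L} then c i else 0)" for i
  define vL where "vL i = (if i \<in> {1..L} then v i else 0)" for i
  have lp: "cL \<in> lp_space p" "vL \<in> lp_space p"
    by (rule finite_support_in_lp_space; force simp: cL_def vL_def intro: finite_subset[of _ "{1..L}"])+
  obtain x where x: "\<And>V1 V2. openin (lp_topology p) V1 \<and> V1 \<noteq> {} \<and> openin (lp_topology p) V2 \<and> V2 \<noteq> {} \<Longrightarrow>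
      infinite {n. n \<ge> 1 \<and> (pseudo_shift f w1 ^^ n) x \<in> V1 \<and> (pseudo_shift f w2 ^^ n) x \<in> V2}"
    using dh unfolding disjoint_hypercyclic_def by meson
  have "infinite {n. n \<ge> 1 \<and> (pseudo_shift f w1 ^^ n) x \<in> lp_ball p cL \<eta>
      \<and> (pseudo_shift f w2 ^^ n) x \<in> lp_ball p vL \<eta>}"
    using openin_lp_ball[OF p] centre_in_lp_ball[OF p _ \<eta>] lp by (intro x) blast
  then obtain n where n: "n \<ge> N0" "(pseudo_shift f w1 ^^ n) x \<in> lp_ball p cL \<eta>"
      "(pseudo_shift f w2 ^^ n) x \<in> lp_ball p vL \<eta>"
    by (auto simp: infinite_nat_iff_unbounded_le)
  have "norm (c i * (weight_prod f w2 n i / weight_prod f w1 n i) - v i) < \<epsilon>"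
    if i: "i \<in> {1..L}" for i
  proof -
    let ?y = "x ((f ^^ n) i)"
    let ?A = "weight_prod f w1 n i * ?y" and ?B = "weight_prod f w2 n i * ?y"
    have A: "norm (?A - c i) < \<eta>"
      using lp_ball_coord[OF p n(2) lp(1), of i] i by (simp add: pseudo_shift_funpow cL_def)
    have B: "norm (?B - v i) < \<eta>"
      using lp_ball_coord[OF p n(3) lp(2), of i] i by (simp add: pseudo_shift_funpow vL_def)
    have "\<eta> \<le> norm (c i) / 2" using \<eta>h[OF i] by (simp add: h_def)
    then have "?A \<noteq> 0" using A \<eta> by force
    then have "weight_prod f w2 n i / weight_prod f w1 n i = ?B / ?A" by simp
    moreover have "norm (c i * (?B / ?A) - v i) < \<epsilon>"
      using \<eta>h[OF i] by (intro norm_mult_ratio_less[OF c[OF i] A B]) (auto simp: h_def)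
    ultimately show ?thesis by simp
  qed
  then show ?thesis using n(1) by blast
qed

text \<open>
  By the cocycle identity \<open>R\<^bsub>N+di\<^esub>(j) = R\<^bsub>di\<^esub>(j) R\<^sub>N(k)\<close> with \<open>k = f\<^bsup>di\<^esup>(j)\<close>, the requirement at time
  \<open>N + d i\<close> and coordinate \<open>j\<close> is a requirement on \<open>R\<^sub>N(k)\<close>. For \<open>d \<ge> l\<close> different pairs \<open>(i, j)\<close> lead
  to different indices \<open>k\<close>, so all these requirements can be imposed on \<open>R\<^sub>N\<close> simultaneously.
\<close>

lemma weight_ratio_along_progression:
  fixes w1 w2 u v :: "nat \<Rightarrow> 'k::{real_normed_field, euclidean_space}"
  defines "R \<equiv> \<lambda>n i. weight_prod f w2 n i / weight_prod f w1 n i"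
  assumes nz: "\<And>n j. j \<ge> 1 \<Longrightarrow> weight_prod f w1 n j \<noteq> 0" "\<And>n j. j \<ge> 1 \<Longrightarrow> weight_prod f w2 n j \<noteq> 0"
    and ratio: "\<And>L c v \<epsilon> N0. (\<And>i. i \<in> {1..L} \<Longrightarrow> c i \<noteq> 0) \<Longrightarrow> 0 < \<epsilon> \<Longrightarrow>
          \<exists>n\<ge>N0. \<forall>i\<in>{1..L}. norm (c i * R n i - v i) < \<epsilon>"
    and d: "l \<le> d" and u: "\<And>j. j \<in> {1..l} \<Longrightarrow> u j \<noteq> 0" and \<epsilon>: "0 < \<epsilon>"
  shows "\<exists>N\<ge>N0. \<forall>i\<in>{1..L}. \<forall>j\<in>{1..l}. norm (u j * R (N + d * i) j - v j) < \<epsilon>"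
proof -
  define P where "P = {1..L} \<times> {1..l}"
  define \<phi> where "\<phi> = (\<lambda>(i, j). (f ^^ (d * i)) j)"
  have neq: "\<phi> (i, j) \<noteq> \<phi> (i', j')" if "(i, j) \<in> P" "(i', j') \<in> P" "i < i'" for i j i' j'
  proof -
    have "d * i + l \<le> d * i'" using d that(3)
      by (metis Suc_leI add_le_mono1 add.commute mult_Suc_right mult_le_mono2 order_trans)
    then show ?thesis using that funpow_neq_if_far[of j l j' "d * i" "d * i'"]
      by (auto simp: \<phi>_def P_def)
  qed
  have inj: "inj_on \<phi> P"
  proof (rule inj_onI, clarify)
    fix i j i' j' assume *: "(i, j) \<in> P" "(i', j') \<in> P" "\<phi> (i, j) = \<phi> (i', j')"
    then have "i = i'" using neq by (metis linorder_neqE_nat)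
    then show "i = i' \<and> j = j'" using * funpow_inj[of j j' "d * i"] by (auto simp: \<phi>_def P_def)
  qed
  define \<iota> where "\<iota> = inv_into P \<phi>"
  have \<iota>: "\<iota> (\<phi> z) = z" if "z \<in> P" for z using inj that by (simp add: \<iota>_def)
  \<comment> \<open>The value \<open>1\<close> off \<open>\<phi> ` P\<close> is arbitrary; it only has to be nonzero.\<close>
  define c where "c k = (if k \<in> \<phi> ` P then u (snd (\<iota> k)) * R (d * fst (\<iota> k)) (snd (\<iota> k)) else 1)" for k
  have c0: "c k \<noteq> 0" for k
    by (auto simp: c_def \<iota> P_def R_def u nz)
  obtain n where n: "n \<ge> N0"
    "\<And>k. k \<in> {1..Max (insert 1 (\<phi> ` P))} \<Longrightarrow> norm (c k * R n k - v (snd (\<iota> k))) < \<epsilon>"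
    using ratio[of "Max (insert 1 (\<phi> ` P))" c \<epsilon> N0 "\<lambda>k. v (snd (\<iota> k))"] c0 \<epsilon> by blast
  have "norm (u j * R (n + d * i) j - v j) < \<epsilon>" if ij: "i \<in> {1..L}" "j \<in> {1..l}" for i j
  proof -
    let ?k = "\<phi> (i, j)"
    have P: "(i, j) \<in> P" "?k \<in> \<phi> ` P" using ij by (auto simp: P_def)
    have "?k \<le> Max (insert 1 (\<phi> ` P))" using P by (intro Max_ge) (auto simp: P_def)
    moreover have "?k \<ge> 1" using ij(2) funpow_ge_1[of j] by (simp add: \<phi>_def)
    ultimately have "norm (c ?k * R n ?k - v j) < \<epsilon>" using n(2)[of ?k] \<iota>[OF P(1)] by simp
    moreover have "R (n + d * i) j = R (d * i) j * R n ?k"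
      unfolding R_def add.commute[of n] weight_prod_add \<phi>_def by simp
    moreover have "c ?k = u j * R (d * i) j" using P by (simp add: c_def \<iota>)
    ultimately show ?thesis by (simp add: mult.assoc)
  qed
  then show ?thesis using n(1) by blast
qed

end


section \<open>Construction of a disjoint reiteratively hypercyclic vector\<close>

text \<open>
  Positions of successive blocks: \<open>e s\<close> is the room taken by block \<open>s\<close>, and \<open>\<gamma> s'\<close> the gap
  required between block \<open>s'\<close> and everything before it.
\<close>

lemma spaced_sequence:
  fixes Q :: "nat \<Rightarrow> nat \<Rightarrow> bool"
  assumes "\<And>s N0. \<exists>N\<ge>N0. Q s N"
  shows "\<exists>N. (\<forall>s. Q s (N s) \<and> \<gamma> s \<le> N s) \<and> (\<forall>s s'. s < s' \<longrightarrow> N s + e s + \<gamma> s' \<le> N s')"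
proof -
  define pick where "pick s N0 = (SOME N. N \<ge> N0 \<and> Q s N)" for s N0
  have pick: "pick s N0 \<ge> N0 \<and> Q s (pick s N0)" for s N0
    unfolding pick_def by (rule someI_ex[OF assms])
  define N where "N = rec_nat (pick 0 (\<gamma> 0)) (\<lambda>s r. pick (Suc s) (r + e s + \<gamma> (Suc s)))"
  have step: "N s + e s + \<gamma> (Suc s) \<le> N (Suc s)" for s using pick by (simp add: N_def)
  have incN: "N s \<le> N s'" if "s \<le> s'" for s s'
    using that by (rule lift_Suc_mono_le[rotated]) (use step in \<open>meson add_leD1\<close>)
  have "Q s (N s)" for s using pick by (cases s) (auto simp: N_def)
  moreover have "\<gamma> s \<le> N s" for s using pick by (cases s) (auto simp: N_def intro: add_leD2)
  moreover have "N s + e s + \<gamma> s' \<le> N s'" if less: "s < s'" for s s'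
  proof -
    obtain t where t: "s' = Suc t" "s \<le> t" using less by (cases s') auto
    show ?thesis
    proof (cases "s = t")
      case False
      then have "N (Suc s) \<le> N t" using t by (intro incN) auto
      then show ?thesis using step[of s] step[of t] unfolding t(1) by linarith
    qed (use step t in simp)
  qed
  ultimately show ?thesis by blast
qed

lemma sum_power_half_le: "(\<Sum>i\<in>{m..n}. (1/2) ^ i) \<le> 2 * (1/2::real) ^ m"
proof (cases "m \<le> n")
  case True
  then show ?thesis by (subst sum_gp) (auto simp: field_simps)
qed simp

context index_map
begin

text \<open>
  The size of an orbit at time \<open>n0\<close> away from the target. The vector \<open>x\<close> lives on the indices
  \<open>f\<^sup>n(j)\<close> with \<open>n\<close> in block \<open>s\<close> and \<open>j \<le> l s\<close>. Entries made for times \<open>n < n0\<close> have already left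
  the space by time \<open>n0\<close>, since \<open>n0 - n \<ge> l s\<close>. An entry made for a later time \<open>n\<close> is shown at the
  coordinate \<open>f\<^bsup>n-n0\<^esup>(j)\<close> with the value it has at time \<open>n\<close> divided by \<open>W\<^bsub>n-n0\<^esub>(j)\<close>.
\<close>

lemma orbit_power_sum_le:
  fixes w x :: "nat \<Rightarrow> 'k::{real_normed_field, euclidean_space}" and blk :: "nat \<Rightarrow> nat set"
  assumes nz: "\<And>n j. j \<ge> 1 \<Longrightarrow> weight_prod f w n j \<noteq> 0"
    and fin: "\<And>s. finite (blk s)"
    and supp: "\<And>k. x k \<noteq> 0 \<Longrightarrow> \<exists>s. \<exists>n\<in>blk s. \<exists>j\<in>{1..l s}. k = (f ^^ n) j"
    and bd: "\<And>s n j. n \<in> blk s \<Longrightarrow> j \<in> {1..l s} \<Longrightarrow> norm (weight_prod f w n j * x ((f ^^ n) j)) \<le> \<kappa> s j"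
    and past: "\<And>s n. n \<in> blk s \<Longrightarrow> n < n0 \<Longrightarrow> n + l s \<le> n0"
    and F: "finite F" "F \<subseteq> {1..}" "\<And>s. n0 \<in> blk s \<Longrightarrow> F \<inter> {1..l s} = {}"
    and tail: "\<And>S. (\<Sum>s\<le>S. \<Sum>n\<in>blk s \<inter> {n0<..}. \<Sum>j=1..l s.
        \<kappa> s j powr p * norm (weight_prod f w (n - n0) j) powr (- p)) \<le> t"
    and p: "1 \<le> p"
  shows "(\<Sum>i\<in>F. norm (weight_prod f w n0 i * x ((f ^^ n0) i)) powr p) \<le> t"
proof -
  let ?W = "weight_prod f w"
  let ?b = "\<lambda>i. norm (?W n0 i * x ((f ^^ n0) i)) powr p"
  define F' where "F' = {i\<in>F. x ((f ^^ n0) i) \<noteq> 0}"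
  have "\<exists>s. \<exists>n\<in>blk s \<inter> {n0<..}. \<exists>j\<in>{1..l s}. i = (f ^^ (n - n0)) j" if i: "i \<in> F'" for i
  proof -
    have i1: "i \<ge> 1" "i \<in> F" using i F(2) by (auto simp: F'_def)
    obtain s n j where snj: "n \<in> blk s" "j \<in> {1..l s}" "(f ^^ n0) i = (f ^^ n) j"
      using supp i by (force simp: F'_def)
    have "n \<noteq> n0" using snj i1 F(3)[of s] funpow_inj[of i j n0] by (auto simp: disjoint_iff)
    moreover have "\<not> n < n0" using past[OF snj(1)] funpow_neq_if_far[OF snj(2) i1(1)] snj(3) by metis
    ultimately have "n > n0" by simp
    moreover from this have "i = (f ^^ (n - n0)) j"
      using snj i1(1) by (intro funpow_eq_imp) auto
    ultimately show ?thesis using snj by blast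
  qed
  then obtain blkof where blkof: "\<And>i. i \<in> F' \<Longrightarrow>
      \<exists>n\<in>blk (blkof i) \<inter> {n0<..}. \<exists>j\<in>{1..l (blkof i)}. i = (f ^^ (n - n0)) j" by metis
  have finF': "finite F'" using F(1) by (simp add: F'_def)
  define S where "S = Max (insert 0 (blkof ` F'))"
  have S: "blkof i \<le> S" if "i \<in> F'" for i
    using that finF' by (auto simp: S_def)
  define Z where "Z = (SIGMA s:{..S}. SIGMA n:blk s \<inter> {n0<..}. {1..l s})"
  define \<psi> where "\<psi> = (\<lambda>(s::nat, n, j). (f ^^ (n - n0)) j)"
  have finZ: "finite Z" using fin by (auto simp: Z_def)
  have "F' \<subseteq> \<psi> ` Z"
  proof
    fix i assume i: "i \<in> F'"
    obtain n j where "n \<in> blk (blkof i) \<inter> {n0<..}" "j \<in> {1..l (blkof i)}" "i = (f ^^ (n - n0)) j"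
      using blkof[OF i] by blast
    then show "i \<in> \<psi> ` Z"
      using S[OF i] by (intro image_eqI[of _ _ "(blkof i, n, j)"]) (auto simp: \<psi>_def Z_def)
  qed
  have "sum ?b F = sum ?b F'"
    using F(1) p by (intro sum.mono_neutral_right) (auto simp: F'_def)
  also have "\<dots> \<le> sum ?b (\<psi> ` Z)"
    using \<open>F' \<subseteq> \<psi> ` Z\<close> finZ by (intro sum_mono2) auto
  also have "\<dots> \<le> sum (?b \<circ> \<psi>) Z" using finZ by (intro sum_image_le) auto
  also have "\<dots> \<le> (\<Sum>(s, n, j)\<in>Z. \<kappa> s j powr p * norm (?W (n - n0) j) powr (- p))"
  proof (rule sum_mono, clarify)
    fix s n j assume "(s, n, j) \<in> Z"
    then have n: "n \<in> blk s" "n0 < n" and j: "j \<in> {1..l s}" by (auto simp: Z_def)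
    have "(f ^^ n0) ((f ^^ (n - n0)) j) = (f ^^ n) j"
      using n(2) by (metis funpow_add less_imp_le_nat le_add_diff_inverse o_apply)
    moreover have "?W n j = ?W (n - n0) j * ?W n0 ((f ^^ (n - n0)) j)"
      using weight_prod_add[of f w "n - n0" n0 j] n(2) by simp
    ultimately have "?W n0 (\<psi> (s, n, j)) * x ((f ^^ n0) (\<psi> (s, n, j)))
        = ?W n j * x ((f ^^ n) j) / ?W (n - n0) j"
      using nz[of j "n - n0"] j by (simp add: \<psi>_def field_simps)
    then have "(?b \<circ> \<psi>) (s, n, j)
        = norm (?W n j * x ((f ^^ n) j)) powr p * norm (?W (n - n0) j) powr (- p)"
      by (simp add: norm_divide powr_divide powr_minus_divide)
    also have "\<dots> \<le> \<kappa> s j powr p * norm (?W (n - n0) j) powr (- p)"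
      using bd[OF n(1) j] p by (intro mult_right_mono powr_mono2) auto
    finally show "(?b \<circ> \<psi>) (s, n, j) \<le> \<kappa> s j powr p * norm (?W (n - n0) j) powr (- p)" .
  qed
  also have "\<dots> = (\<Sum>s\<le>S. \<Sum>n\<in>blk s \<inter> {n0<..}. \<Sum>j=1..l s.
        \<kappa> s j powr p * norm (?W (n - n0) j) powr (- p))"
    using fin by (simp add: Z_def sum.Sigma)
  also have "\<dots> \<le> t" by (rule tail)
  finally show ?thesis .
qed

text \<open>
  The universal vector. The blocks are indexed by triples: a list \<open>z\<close> of pairs encoding the targets
  \<open>u z\<close> and \<open>v z\<close>, an accuracy \<open>m\<close>, and a length \<open>L\<close>. Block \<open>s\<close> consists of the times
  \<open>N s + d s, \<dots>, N s + d s * L s\<close>. For the density of the visits it is essential that the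
  step \<open>d s\<close> depends only on the targets and the accuracy, and not on the length. The errors come
  from later times in the same block, at most \<open>(1/2) ^ m s\<close> by the choice of \<open>d s\<close>, and from later
  blocks \<open>s'\<close>, at most \<open>(1/2) ^ s'\<close> each by the choice of the gap before \<open>s'\<close>. The second kind
  is compatible with accuracy \<open>m s\<close> only for \<open>s \<ge> m s\<close>, which costs nothing, as infinitely many
  blocks with given targets and accuracy are available.
\<close>

lemma disjoint_reiteratively_hypercyclicI:
  fixes w1 w2 :: "nat \<Rightarrow> 'k::{real_normed_field, euclidean_space}"
  defines "R \<equiv> \<lambda>n i. weight_prod f w2 n i / weight_prod f w1 n i"
  assumes p: "1 \<le> p" and w: "bounded (w1 ` {1..})" "bounded (w2 ` {1..})"
    and nz1: "\<And>n j. j \<ge> 1 \<Longrightarrow> weight_prod f w1 n j \<noteq> 0"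
    and nz2: "\<And>n j. j \<ge> 1 \<Longrightarrow> weight_prod f w2 n j \<noteq> 0"
    and sum1: "\<And>j. j \<ge> 1 \<Longrightarrow> summable (\<lambda>q. norm (weight_prod f w1 q j) powr (- p))"
    and sum2: "\<And>j. j \<ge> 1 \<Longrightarrow> summable (\<lambda>q. norm (weight_prod f w2 q j) powr (- p))"
    and ratio: "\<And>L c v \<epsilon> N0. (\<And>i. i \<in> {1..L} \<Longrightarrow> c i \<noteq> 0) \<Longrightarrow> 0 < \<epsilon> \<Longrightarrow>
          \<exists>n\<ge>N0. \<forall>i\<in>{1..L}. norm (c i * R n i - v i) < \<epsilon>"
  shows "disjoint_reiteratively_hypercyclic (lp_topology p) (pseudo_shift f w1) (pseudo_shift f w2)"
proof -
  let ?T1 = "pseudo_shift f w1" and ?T2 = "pseudo_shift f w2"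
  let ?W1 = "weight_prod f w1" and ?W2 = "weight_prod f w2"
  obtain D0 :: "'k set" where D0: "countable D0" "\<And>X. open X \<Longrightarrow> X \<noteq> {} \<Longrightarrow> \<exists>d\<in>D0. d \<in> X"
    using countable_dense_exists[where ?'a = 'k] by blast
  \<comment> \<open>The entries of \<open>u z\<close> occur as denominators when the ratios \<open>v z j / u z j\<close> are prescribed.\<close>
  define D where "D = D0 - {0}"
  have D: "countable D" "\<exists>d\<in>D. d \<in> X" if "open X" "X \<noteq> {}" for X
  proof -
    show "countable D" using D0(1) by (simp add: D_def)
    have "X \<noteq> {0}" using that(1) not_open_singleton by metis
    then have "X - {0} \<noteq> {}" using that(2) by blast
    moreover have "open (X - {0})" using that(1) by (simp add: open_Diff)
    ultimately show "\<exists>d\<in>D. d \<in> X" using D0(2)[of "X - {0}"] by (auto simp: D_def)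
  qed
  define I where "I = (lists (D \<times> D) \<times> (UNIV :: nat set)) \<times> (UNIV :: nat set)"
  have "(([], 0), 0) \<in> I" by (simp add: I_def)
  then have I: "countable I" "I \<noteq> {}" using D(1)[of UNIV] by (auto simp: I_def)
  define idx where "idx = from_nat_into I"
  have idx: "range idx = I"
    unfolding idx_def using I by (intro range_from_nat_into)
  define zs where "zs s = fst (fst (idx s))" for s
  define m where "m s = snd (fst (idx s))" for s
  define L where "L s = snd (idx s)" for s
  define u where "u z = vec_of_list (map fst z)" for z :: "('k \<times> 'k) list"
  define v where "v z = vec_of_list (map snd z)" for z :: "('k \<times> 'k) list"
  define l where "l s = length (zs s)" for s
  have zsD: "zs s \<in> lists (D \<times> D)" for s
    using idx rangeI[of idx s] by (auto simp: zs_def I_def)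
  have u0: "u (zs s) j \<noteq> 0" if "j \<in> {1..l s}" for s j
  proof -
    have "zs s ! (j - 1) \<in> set (zs s)" using that by (intro nth_mem) (auto simp: l_def)
    then have "zs s ! (j - 1) \<in> D \<times> D" using zsD[of s] by auto
    then have "fst (zs s ! (j - 1)) \<noteq> 0" by (auto simp: D_def)
    then show ?thesis using that by (auto simp: u_def vec_of_list_def l_def)
  qed
  \<comment> \<open>A bound for the entries which the two orbits show at the times of a block: exactly \<open>u z j\<close>
    for the first orbit, and up to an error of \<open>1\<close> equal to \<open>v z j\<close> for the second.\<close>
  define \<kappa> where "\<kappa> z j = norm (u z j) + norm (v z j) + 1" for z j
  define a where "a q j = norm (?W1 q j) powr (- p) + norm (?W2 q j) powr (- p)" for q j
  define g where "g z q = (\<Sum>j=1..length z. \<kappa> z j powr p * a q j)" for z q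
  have g0: "0 \<le> g z q" for z q
    unfolding g_def a_def by (intro sum_nonneg mult_nonneg_nonneg add_nonneg_nonneg) auto
  have sumg: "summable (g z)" for z
    unfolding g_def a_def by (intro summable_sum summable_mult summable_add sum1 sum2) auto
  \<comment> \<open>\<open>t z k\<close> is a distance after which entries for the target \<open>z\<close> are negligible up to \<open>(1/2) ^ k\<close>.
    It is used with \<open>k = m s\<close> as the step of block \<open>s\<close> and with \<open>k = s\<close> as the gap before it.\<close>
  have "\<exists>t\<ge>1. length z \<le> t \<and> (\<forall>Q. finite Q \<and> Q \<subseteq> {t..} \<longrightarrow> sum (g z) Q \<le> (1/2) ^ k)" for z and k :: nat
  proof -
    obtain t where t: "\<And>i n. i \<ge> t \<Longrightarrow> norm (sum (g z) {i..n}) < (1/2) ^ k"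
      using summable_partial_sum_bound[OF sumg, of "(1/2) ^ k" z] by auto
    have "sum (g z) Q \<le> (1/2) ^ k" if Q: "finite Q" "Q \<subseteq> {t + length z + 1..}" for Q
    proof -
      have "Q \<subseteq> {t..Max (insert 0 Q)}" using Q by (auto dest!: subsetD)
      then have "sum (g z) Q \<le> sum (g z) {t..Max (insert 0 Q)}"
        by (intro sum_mono2) (auto simp: g0)
      then show ?thesis using t[of t "Max (insert 0 Q)"] by auto
    qed
    then show ?thesis by (intro exI[of _ "t + length z + 1"]) auto
  qed
  then obtain t where t: "\<And>z k. 1 \<le> t z k" "\<And>z k. length z \<le> t z k"
    "\<And>z k Q. finite Q \<Longrightarrow> Q \<subseteq> {t z k..} \<Longrightarrow> sum (g z) Q \<le> (1/2) ^ k"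
    by metis
  define d where "d s = t (zs s) (m s)" for s
  \<comment> \<open>chosen so that an error of \<open>\<epsilon> s\<close> in each of the \<open>l s\<close> coordinates costs at most \<open>(1/2) ^ m s\<close>\<close>
  define \<epsilon> where "\<epsilon> s = min 1 (((1/2) ^ m s / (real (l s) + 1)) powr (1 / p))" for s
  have \<epsilon>: "\<epsilon> s > 0" "\<epsilon> s \<le> 1" "\<epsilon> s powr p \<le> (1/2) ^ m s / (real (l s) + 1)" for s
  proof -
    let ?c = "(1/2) ^ m s / (real (l s) + 1)"
    have "?c > 0" by (intro divide_pos_pos) auto
    then show "\<epsilon> s > 0" by (simp add: \<epsilon>_def)
    then have "\<epsilon> s powr p \<le> (?c powr (1 / p)) powr p"
      using p by (intro powr_mono2) (auto simp: \<epsilon>_def)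
    also have "\<dots> = ?c" using p \<open>?c > 0\<close> by (simp add: powr_powr)
    finally show "\<epsilon> s powr p \<le> ?c" .
  qed (simp add: \<epsilon>_def)
  define good where "good s N \<longleftrightarrow> (\<forall>i\<in>{1..L s}. \<forall>j\<in>{1..l s}.
      norm (u (zs s) j * R (N + d s * i) j - v (zs s) j) < \<epsilon> s)" for s N
  have positions: "\<exists>N\<ge>N0. good s N" for s N0
    unfolding R_def good_def
  proof (rule weight_ratio_along_progression[OF nz1 nz2])
    show "l s \<le> d s" using t(2) by (simp add: d_def l_def)
  qed (use u0 \<epsilon> ratio in \<open>auto simp: R_def\<close>)
  obtain N where N: "\<And>s. good s (N s)" "\<And>s. t (zs s) s \<le> N s"
      "\<And>s s'. s < s' \<Longrightarrow> N s + (d s * L s + l s) + t (zs s') s' \<le> N s'"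
    using spaced_sequence[of good "\<lambda>s. t (zs s) s" "\<lambda>s. d s * L s + l s", OF positions] by auto
  define blk where "blk s = (\<lambda>i. N s + d s * i) ` {1..L s}" for s
  have d: "d s \<ge> 1" "l s \<le> d s" for s using t(1,2) by (auto simp: d_def l_def)
  have finblk: "finite (blk s)" for s by (simp add: blk_def)
  have blk_bounds: "N s < n" "n \<le> N s + d s * L s" if "n \<in> blk s" for n s
    using that d(1)[of s] by (auto simp: blk_def Suc_le_eq)
  have blk_later: "n + l s + t (zs s') s' \<le> n'" if "n \<in> blk s" "n' \<in> blk s'" "s < s'" for n n' s s'
    using blk_bounds[OF that(1)] blk_bounds[OF that(2)] N(3)[OF that(3)] by linarith
  have blk_same: "n + d s \<le> n'" if n: "n \<in> blk s" "n' \<in> blk s" "n < n'" for n n' s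
  proof -
    obtain i i' where i: "n = N s + d s * i" "n' = N s + d s * i'" using n(1,2) by (auto simp: blk_def)
    then have "i + 1 \<le> i'" using n(3) by simp
    then have "d s * (i + 1) \<le> d s * i'" by (rule mult_le_mono2)
    then show ?thesis using i by simp
  qed
  have blk_order: "s \<le> s'" if "n \<in> blk s" "n' \<in> blk s'" "n \<le> n'" for n n' s s'
  proof (rule ccontr)
    assume "\<not> s \<le> s'"
    then show False using blk_later[OF that(2,1)] t(1)[of "zs s" s] that(3) by simp
  qed
  have blk_sep: "n + l s \<le> n'" if n: "n \<in> blk s" "n' \<in> blk s'" "n < n'" for n n' s s'
  proof (cases "s = s'")
    case True
    then show ?thesis using blk_same[of n s n'] n d(2)[of s] by simp
  next
    case False
    then have "s < s'" using blk_order[OF n(1,2)] n(3) by simp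
    then show ?thesis using blk_later[OF n(1,2)] by simp
  qed
  \<comment> \<open>The indices \<open>f\<^sup>n(j)\<close> used by the blocks are pairwise different, so the entries of \<open>x\<close> at
    them can be chosen independently.\<close>
  define P where "P = (SIGMA s:UNIV. blk s \<times> {1..l s})"
  define \<phi> where "\<phi> = (\<lambda>(s::nat, n, j). (f ^^ n) j)"
  have inj: "inj_on \<phi> P"
  proof (rule inj_onI)
    fix y y' assume y: "y \<in> P" "y' \<in> P" "\<phi> y = \<phi> y'"
    obtain s n j s' n' j' where eq: "y = (s, n, j)" "y' = (s', n', j')"
      using prod_cases3 by metis
    note * = y[unfolded eq]
    have neq: "\<phi> (s, n, j) \<noteq> \<phi> (s', n', j')" if "(s, n, j) \<in> P" "(s', n', j') \<in> P" "n < n'" for s n j s' n' j'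
      using that blk_sep[of n s n' s'] funpow_neq_if_far[of j "l s" j' n n'] by (auto simp: P_def \<phi>_def)
    have "n = n'" using neq * by (metis linorder_neqE_nat)
    moreover from this have "s = s'" using * blk_order[of n s n' s'] blk_order[of n' s' n s]
      by (auto simp: P_def)
    ultimately show "y = y'"
      using * funpow_inj[of j j' n] by (auto simp: eq P_def \<phi>_def)
  qed
  define val where "val = (\<lambda>(s, n, j). u (zs s) j / ?W1 n j)"
  define x where "x k = (if k \<in> \<phi> ` P then val (inv_into P \<phi> k) else 0)" for k
  have x: "x ((f ^^ n) j) = u (zs s) j / ?W1 n j" if "n \<in> blk s" "j \<in> {1..l s}" for s n j
  proof -
    have z: "(s, n, j) \<in> P" using that by (simp add: P_def)
    have "(f ^^ n) j = \<phi> (s, n, j)" by (simp add: \<phi>_def)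
    then show ?thesis using inv_into_f_f[OF inj z] z by (simp add: x_def val_def)
  qed
  have supp: "\<exists>s. \<exists>n\<in>blk s. \<exists>j\<in>{1..l s}. k = (f ^^ n) j" if "x k \<noteq> 0" for k
    using that by (fastforce simp: x_def P_def \<phi>_def split: if_splits)
  have x0: "x 0 = 0"
  proof (rule ccontr)
    assume "x 0 \<noteq> 0"
    then obtain n j where "j \<ge> 1" "0 = (f ^^ n) j" using supp by fastforce
    then show False using funpow_ge_1[of j n] by simp
  qed
  have W1x: "?W1 n j * x ((f ^^ n) j) = u (zs s) j" if "n \<in> blk s" "j \<in> {1..l s}" for s n j
    using x[OF that] nz1[of j n] that by simp
  have W2x: "norm (?W2 n j * x ((f ^^ n) j) - v (zs s) j) < \<epsilon> s" if "n \<in> blk s" "j \<in> {1..l s}" for s n j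
  proof -
    have "?W2 n j * x ((f ^^ n) j) = u (zs s) j * R n j"
      using x[OF that] by (simp add: R_def)
    then show ?thesis using N(1)[of s] that by (auto simp: blk_def good_def)
  qed
  have \<kappa>1: "norm (?W1 n j * x ((f ^^ n) j)) \<le> \<kappa> (zs s) j" if "n \<in> blk s" "j \<in> {1..l s}" for s n j
    using W1x[OF that] by (simp add: \<kappa>_def)
  have \<kappa>2: "norm (?W2 n j * x ((f ^^ n) j)) \<le> \<kappa> (zs s) j" if "n \<in> blk s" "j \<in> {1..l s}" for s n j
    using W2x[OF that] \<epsilon>(2)[of s] norm_triangle_sub[of "?W2 n j * x ((f ^^ n) j)" "v (zs s) j"]
      norm_ge_zero[of "u (zs s) j"] unfolding \<kappa>_def by linarith

  \<comment> \<open>the contribution of block \<open>s\<close> to both orbits at the earlier time \<open>n\<close>\<close>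
  define later where "later n s = (\<Sum>n'\<in>blk s \<inter> {n<..}. g (zs s) (n' - n))" for n s
  have later_le: "later n s \<le> (1/2) ^ k" if "\<And>n'. n' \<in> blk s \<Longrightarrow> n < n' \<Longrightarrow> n + t (zs s) k \<le> n'" for n s k
  proof -
    have "later n s = sum (g (zs s)) ((\<lambda>n'. n' - n) ` (blk s \<inter> {n<..}))"
      unfolding later_def by (subst sum.reindex) (auto simp: inj_on_def)
    also have "\<dots> \<le> (1/2) ^ k" using finblk that by (intro t(3)) force+
    finally show ?thesis .
  qed
  have later_sum_le: "(\<Sum>s'\<le>S. later n s') \<le> (1/2) ^ m s + 2 * (1/2) ^ Suc s" if n: "n \<in> blk s" for n s S
  proof -
    have "later n s' \<le> (if s' = s then (1/2) ^ m s else 0) + (if s < s' then (1/2) ^ s' else 0)" for s'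
    proof -
      consider "s' < s" | "s' = s" | "s < s'" by linarith
      then show ?thesis
      proof cases
        case 1
        then have "blk s' \<inter> {n<..} = {}" using blk_order[OF n] by force
        then show ?thesis by (simp add: later_def)
      next
        case 2
        then show ?thesis using later_le[of s n "m s"] blk_same[OF n] by (simp add: d_def)
      next
        case 3
        have "later n s' \<le> (1/2) ^ s'"
        proof (rule later_le)
          fix n' assume "n' \<in> blk s'"
          then show "n + t (zs s') s' \<le> n'" using blk_later[OF n _ 3] by fastforce
        qed
        then show ?thesis using 3 by simp
      qed
    qed
    then have "(\<Sum>s'\<le>S. later n s') \<le>
        (\<Sum>s'\<le>S. (if s' = s then (1/2) ^ m s else 0) + (if s < s' then (1/2) ^ s' else 0))"
      by (rule sum_mono)
    also have "\<dots> = (\<Sum>s'\<le>S. if s' = s then (1/2) ^ m s else 0) + (\<Sum>s'\<le>S. if s < s' then (1/2) ^ s' else 0)"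
      by (rule sum.distrib)
    also have "(\<Sum>s'\<le>S. if s < s' then (1/2) ^ s' else 0) = (\<Sum>s'\<in>{Suc s..S}. (1/2 :: real) ^ s')"
      by (subst sum.inter_filter[symmetric]) (auto intro!: sum.cong)
    also have "\<dots> \<le> 2 * (1/2) ^ Suc s" by (rule sum_power_half_le)
    also have "(\<Sum>s'\<le>S. if s' = s then (1/2) ^ m s else 0) \<le> (1/2 :: real) ^ m s" by simp
    finally show ?thesis by simp
  qed
  have tail: "(\<Sum>s\<le>S. \<Sum>n'\<in>blk s \<inter> {n<..}. \<Sum>j=1..l s. \<kappa> (zs s) j powr p * norm (weight_prod f w (n' - n) j) powr (- p))
      \<le> (\<Sum>s\<le>S. later n s)" if "w \<in> {w1, w2}" for w S n
    unfolding later_def g_def l_def a_def using that by (intro sum_mono mult_left_mono) auto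

  \<comment> \<open>Membership in the space is the orbit estimate at time \<open>0\<close>, which precedes all blocks.\<close>
  have xlp: "x \<in> lp_space p"
  proof (rule lp_spaceI_finite_sums(1)[where z = x and c = 2, OF p x0])
    fix F :: "nat set" assume F: "finite F" "F \<subseteq> {1..}"
    have "(\<Sum>i\<in>F. norm (?W1 0 i * x ((f ^^ 0) i)) powr p) \<le> 2"
    proof (rule orbit_power_sum_le[where w = w1 and x = x and blk = blk and l = l and p = p
          and \<kappa> = "\<lambda>s. \<kappa> (zs s)" and ?n0.0 = 0])
      show "F \<inter> {1..l s} = {}" if "0 \<in> blk s" for s using blk_bounds(1)[OF that] by simp
      fix S
      have "later 0 s \<le> (1/2) ^ s" for s
        using N(2)[of s] blk_bounds(1)[of _ s] by (intro later_le) force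
      then have "(\<Sum>s\<le>S. later 0 s) \<le> (\<Sum>s\<in>{0..S}. (1/2) ^ s)"
        unfolding atMost_atLeast0 by (rule sum_mono)
      also have "\<dots> \<le> 2" using sum_power_half_le[of 0 S] by simp
      finally show "(\<Sum>s\<le>S. \<Sum>n'\<in>blk s \<inter> {0<..}. \<Sum>j=1..l s.
          \<kappa> (zs s) j powr p * norm (?W1 (n' - 0) j) powr (- p)) \<le> 2"
        using tail[of w1 0 S] by simp
    qed (use nz1 finblk supp \<kappa>1 F p in auto)
    then show "(\<Sum>i\<in>F. norm (x i) powr p) \<le> 2" by (simp add: weight_prod_def)
  qed

  have close: "(pseudo_shift f w ^^ n) x \<in> lp_ball p (vec_of_list ts) \<rho>"
    if w: "w \<in> {w1, w2}" and n: "n \<in> blk s" and s: "m s \<le> s" and ts: "length ts = l s"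
      and nzw: "\<And>n j. j \<ge> 1 \<Longrightarrow> weight_prod f w n j \<noteq> 0"
      and \<kappa>: "\<And>s n j. n \<in> blk s \<Longrightarrow> j \<in> {1..l s} \<Longrightarrow> norm (weight_prod f w n j * x ((f ^^ n) j)) \<le> \<kappa> (zs s) j"
      and head: "\<And>j. j \<in> {1..l s} \<Longrightarrow> norm (weight_prod f w n j * x ((f ^^ n) j) - vec_of_list ts j) \<le> \<epsilon> s"
      and \<rho>: "\<rho> > 0" "3 * (1/2) ^ m s < \<rho> powr p"
    for w n s ts \<rho>
  proof -
    let ?y = "(pseudo_shift f w ^^ n) x"
    let ?b = "\<lambda>i. norm (?y i - vec_of_list ts i) powr p"
    have ylp: "?y \<in> lp_space p"
      using w \<open>bounded (w1 ` {1..})\<close> \<open>bounded (w2 ` {1..})\<close>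
      by (intro pseudo_shift_funpow_in_lp_space[OF p _ xlp]) auto
    have y0: "?y 0 - vec_of_list ts 0 = 0"
      using pseudo_shift_funpow_0[of x, OF x0] by (simp add: vec_of_list_def)
    have "sum ?b F \<le> 3 * (1/2) ^ m s" if F: "finite F" "F \<subseteq> {1..}" for F
    proof -
      have "sum ?b F \<le> sum ?b ({1..l s} \<union> (F - {1..l s}))"
        using F by (intro sum_mono2) auto
      also have "\<dots> = sum ?b {1..l s} + sum ?b (F - {1..l s})"
        using F by (intro sum.union_disjoint) auto
      also have "sum ?b {1..l s} \<le> (\<Sum>j\<in>{1..l s}. (1/2) ^ m s / (real (l s) + 1))"
      proof (rule sum_mono)
        fix j assume j: "j \<in> {1..l s}"
        have "?b j \<le> \<epsilon> s powr p"
          using head[OF j] j p by (intro powr_mono2) (auto simp: pseudo_shift_funpow)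
        then show "?b j \<le> (1/2) ^ m s / (real (l s) + 1)" using \<epsilon>(3)[of s] by simp
      qed
      also have "\<dots> \<le> (1/2) ^ m s" by (simp add: divide_le_eq)
      also have "sum ?b (F - {1..l s}) = (\<Sum>i\<in>F - {1..l s}. norm (weight_prod f w n i * x ((f ^^ n) i)) powr p)"
        using F(2) ts by (intro sum.cong refl) (auto simp: vec_of_list_def pseudo_shift_funpow subset_iff)
      also have "\<dots> \<le> (1/2) ^ m s + 2 * (1/2) ^ Suc s"
      proof (rule orbit_power_sum_le[where w = w and x = x and blk = blk and l = l and p = p
            and \<kappa> = "\<lambda>s. \<kappa> (zs s)" and ?n0.0 = n])
        show "n' + l s' \<le> n" if "n' \<in> blk s'" "n' < n" for s' n' using blk_sep[OF that(1) n that(2)] .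
        show "(F - {1..l s}) \<inter> {1..l s'} = {}" if "n \<in> blk s'" for s'
          using blk_order[OF n that] blk_order[OF that n] by (auto simp: le_antisym)
        show "(\<Sum>s\<le>S. \<Sum>n'\<in>blk s \<inter> {n<..}. \<Sum>j=1..l s.
          \<kappa> (zs s) j powr p * norm (weight_prod f w (n' - n) j) powr (- p)) \<le> (1/2) ^ m s + 2 * (1/2) ^ Suc s" for S
          using tail[OF w, of n S] later_sum_le[OF n, of S] by simp
      qed (use nzw finblk supp \<kappa> F p in auto)
      also have "2 * (1/2) ^ Suc s \<le> (1/2 :: real) ^ m s"
        using power_decreasing[OF s, of "1/2 :: real"] by simp
      finally show ?thesis by simp
    qed
    then have "lp_dist p ?y (vec_of_list ts) \<le> (3 * (1/2) ^ m s) powr (1 / p)"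
      unfolding lp_dist_def by (rule lp_spaceI_finite_sums(2)[where z = "\<lambda>i. ?y i - vec_of_list ts i", OF p y0])
    also have "\<dots> < (\<rho> powr p) powr (1 / p)" using p \<rho> by (intro powr_less_mono2) auto
    also have "\<dots> = \<rho>" using p \<rho>(1) by (simp add: powr_powr)
    finally show ?thesis using ylp by (simp add: lp_ball_def)
  qed

  have "{n. n \<ge> 1 \<and> (?T1 ^^ n) x \<in> V1 \<and> (?T2 ^^ n) x \<in> V2} \<in> positive_upper_Banach"
    if V: "openin (lp_topology p) V1" "V1 \<noteq> {}" "openin (lp_topology p) V2" "V2 \<noteq> {}" for V1 V2
  proof -
    obtain l1 where l1: "\<And>l. l \<ge> l1 \<Longrightarrow> \<exists>us. length us = l \<and> set us \<subseteq> D \<and> vec_of_list us \<in> V1"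
      using openin_lp_topology_contains_vec_of_list[OF p V(1,2) D(2)] by blast
    obtain l2 where l2: "\<And>l. l \<ge> l2 \<Longrightarrow> \<exists>vs. length vs = l \<and> set vs \<subseteq> D \<and> vec_of_list vs \<in> V2"
      using openin_lp_topology_contains_vec_of_list[OF p V(3,4) D(2)] by blast
    obtain us where us: "length us = max l1 l2" "set us \<subseteq> D" "vec_of_list us \<in> V1" using l1[of "max l1 l2"] by auto
    obtain vs where vs: "length vs = max l1 l2" "set vs \<subseteq> D" "vec_of_list vs \<in> V2" using l2[of "max l1 l2"] by auto
    obtain r1 where r1: "r1 > 0" "lp_ball p (vec_of_list us) r1 \<subseteq> V1"
      using openin_lp_topology_ball[OF p V(1) us(3)] by blast
    obtain r2 where r2: "r2 > 0" "lp_ball p (vec_of_list vs) r2 \<subseteq> V2"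
      using openin_lp_topology_ball[OF p V(3) vs(3)] by blast
    define \<rho> where "\<rho> = min r1 r2"
    have \<rho>: "\<rho> > 0" using r1 r2 by (simp add: \<rho>_def)
    then have "\<rho> powr p / 3 > 0" by simp
    then obtain k where "(1/2) ^ k < \<rho> powr p / 3" using real_arch_pow_inv[of "\<rho> powr p / 3" "1/2"] by auto
    then have k: "3 * (1/2) ^ k < \<rho> powr p" by simp
    define z where "z = zip us vs"
    have z: "map fst z = us" "map snd z = vs" "length z = max l1 l2"
      using us(1) vs(1) by (auto simp: z_def)
    have zD: "z \<in> lists (D \<times> D)"
    proof -
      have "a \<in> D \<and> b \<in> D" if "(a, b) \<in> set z" for a b
        using set_zip_leftD[OF that[unfolded z_def]] set_zip_rightD[OF that[unfolded z_def]] us(2) vs(2)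
        by (simp add: subset_iff)
      then show ?thesis by (simp add: in_lists_conv_set split_paired_all)
    qed
    let ?E = "{n. n \<ge> 1 \<and> (?T1 ^^ n) x \<in> V1 \<and> (?T2 ^^ n) x \<in> V2}"
    have E: "n \<in> ?E" if n: "n \<in> blk s" and s: "k \<le> s" "zs s = z" "m s = k" for n s
    proof -
      have len: "length us = l s" "length vs = l s" using z us(1) vs(1) s by (auto simp: l_def)
      have uv: "u (zs s) = vec_of_list us" "v (zs s) = vec_of_list vs"
        using s z by (auto simp: u_def v_def)
      have "(?T1 ^^ n) x \<in> lp_ball p (vec_of_list us) \<rho>"
        using n s len(1) \<rho> k W1x[OF n] \<epsilon>(1)[of s] by (intro close[OF _ n _ _ nz1 \<kappa>1]) (auto simp: uv)
      moreover have "(?T2 ^^ n) x \<in> lp_ball p (vec_of_list vs) \<rho>"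
        using n s len(2) \<rho> k W2x[OF n] by (intro close[OF _ n _ _ nz2 \<kappa>2]) (auto simp: uv less_imp_le)
      moreover have "lp_ball p (vec_of_list us) \<rho> \<subseteq> V1" "lp_ball p (vec_of_list vs) \<rho> \<subseteq> V2"
        using r1(2) r2(2) by (auto simp: lp_ball_def \<rho>_def)
      moreover have "n \<ge> 1" using blk_bounds(1)[OF n] by simp
      ultimately show ?thesis by auto
    qed
    have "\<exists>N'\<ge>1. \<forall>i\<in>{1..L'}. N' + t z k * i \<in> ?E" for L'
    proof -
      let ?J = "{s. \<exists>i. idx s = ((z, k), L' + i)}"
      have "(\<lambda>i. ((z, k), L' + i)) ` UNIV \<subseteq> idx ` ?J"
      proof clarify
        fix i
        have "((z, k), L' + i) \<in> range idx" using zD by (simp add: idx I_def)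
        then obtain s where s: "idx s = ((z, k), L' + i)" by (metis rangeE)
        then show "((z, k), L' + i) \<in> idx ` ?J" by (intro image_eqI[of _ _ s]) auto
      qed
      moreover have "infinite ((\<lambda>i::nat. ((z, k), L' + i)) ` UNIV)"
        by (subst finite_image_iff) (auto simp: inj_on_def)
      ultimately have "infinite ?J" by (meson finite_imageI finite_subset)
      then obtain s where s: "s \<ge> k" "s \<in> ?J" using infinite_nat_iff_unbounded_le by meson
      then have s': "zs s = z" "m s = k" "L' \<le> L s" by (auto simp: zs_def m_def L_def)
      have "N s + t z k * i \<in> blk s" if "i \<in> {1..L'}" for i
        using that s' by (auto simp: blk_def d_def)
      moreover have "N s \<ge> 1" using N(2)[of s] t(1)[of "zs s" s] by linarith
      ultimately show ?thesis using E s(1) s' by blast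
    qed
    then show ?thesis using t(1) by (intro positive_upper_Banach_if_progressions[of _ "t z k"]) auto
  qed
  then show ?thesis
    unfolding disjoint_reiteratively_hypercyclic_def using xlp topspace_lp_topology[OF p] by blast
qed

end


section \<open>The equivalence\<close>

lemma disjoint_reiteratively_hypercyclic_imp_disjoint_hypercyclic:
  "disjoint_reiteratively_hypercyclic X T1 T2 \<Longrightarrow> disjoint_hypercyclic X T1 T2"
  unfolding disjoint_reiteratively_hypercyclic_def disjoint_hypercyclic_def
  using positive_upper_Banach_imp_infinite by meson

lemma disjoint_reiteratively_hypercyclic_imp_each:
  assumes hc: "disjoint_reiteratively_hypercyclic X T1 T2"
    and T: "T1 \<in> topspace X \<rightarrow> topspace X" "T2 \<in> topspace X \<rightarrow> topspace X"
  shows "reiteratively_hypercyclic X T1" "reiteratively_hypercyclic X T2"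
proof -
  obtain x where x: "x \<in> topspace X"
    and vis: "\<And>V1 V2. openin X V1 \<Longrightarrow> V1 \<noteq> {} \<Longrightarrow> openin X V2 \<Longrightarrow> V2 \<noteq> {} \<Longrightarrow>
        {n. n \<ge> 1 \<and> (T1 ^^ n) x \<in> V1 \<and> (T2 ^^ n) x \<in> V2} \<in> positive_upper_Banach"
    using hc unfolding disjoint_reiteratively_hypercyclic_def by meson
  have orbit: "(T ^^ n) x \<in> topspace X" if "T \<in> topspace X \<rightarrow> topspace X" for T n
    using that x by (induction n) auto
  have "topspace X \<noteq> {}" using x by blast
  then show "reiteratively_hypercyclic X T1"
    using x vis[of _ "topspace X"] orbit[OF T(2)] by (auto simp: reiteratively_hypercyclic_def)
  show "reiteratively_hypercyclic X T2"
    using x vis[of "topspace X"] orbit[OF T(1)] \<open>topspace X \<noteq> {}\<close>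
    by (auto simp: reiteratively_hypercyclic_def)
qed

theorem theorem4p3:
  fixes p :: real
    and f1 f2 :: "nat \<Rightarrow> nat"
    and w1 w2 :: "nat \<Rightarrow> 'k::{real_normed_field, euclidean_space}"
  assumes "1 \<le> p"
    and "f1 \<in> {1..} \<rightarrow> {1..}" "strict_mono_on {1..} f1" "f1 1 > 1"
    and "f2 \<in> {1..} \<rightarrow> {1..}" "strict_mono_on {1..} f2" "f2 1 > 1"
    and "bounded (w1 ` {1..})" "bounded (w2 ` {1..})"
    and "almost_partition_regular f1 f2 positive_upper_Banach"
    and "\<forall>j\<ge>1. f1 j = f2 j"
  shows "disjoint_reiteratively_hypercyclic (lp_topology p) (pseudo_shift f1 w1) (pseudo_shift f2 w2)
    \<longleftrightarrow> reiteratively_hypercyclic (lp_topology p) (pseudo_shift f1 w1)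
      \<and> reiteratively_hypercyclic (lp_topology p) (pseudo_shift f2 w2)
      \<and> disjoint_hypercyclic (lp_topology p) (pseudo_shift f1 w1) (pseudo_shift f2 w2)"
proof -
  note p = assms(1) and w = assms(8,9)
  have T2: "pseudo_shift f2 w2 = pseudo_shift f1 w2"
    using assms(11) by (auto simp: pseudo_shift_def fun_eq_iff)
  interpret index_map f1 using assms(2-4) by unfold_locales
  show ?thesis
    unfolding T2
  proof (intro iffI conjI; (elim conjE)?)
    assume hc: "disjoint_reiteratively_hypercyclic (lp_topology p) (pseudo_shift f1 w1) (pseudo_shift f1 w2)"
    have "pseudo_shift f1 w \<in> topspace (lp_topology p) \<rightarrow> topspace (lp_topology p)"
      if "bounded (w ` {1..})" for w :: "nat \<Rightarrow> 'k"
      using pseudo_shift_in_lp_space[OF p maps mono that] by (simp add: topspace_lp_topology[OF p])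
    note each = disjoint_reiteratively_hypercyclic_imp_each[OF hc this[OF w(1)] this[OF w(2)]]
    show "reiteratively_hypercyclic (lp_topology p) (pseudo_shift f1 w1)" by (rule each)
    show "reiteratively_hypercyclic (lp_topology p) (pseudo_shift f1 w2)" by (rule each)
    show "disjoint_hypercyclic (lp_topology p) (pseudo_shift f1 w1) (pseudo_shift f1 w2)"
      by (rule disjoint_reiteratively_hypercyclic_imp_disjoint_hypercyclic[OF hc])
  next
    assume "reiteratively_hypercyclic (lp_topology p) (pseudo_shift f1 w1)"
      and "reiteratively_hypercyclic (lp_topology p) (pseudo_shift f1 w2)"
      and dh: "disjoint_hypercyclic (lp_topology p) (pseudo_shift f1 w1) (pseudo_shift f1 w2)"
    note decay1 = reiteratively_hypercyclic_imp_summable[OF p w(1) this(1)]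
      and decay2 = reiteratively_hypercyclic_imp_summable[OF p w(2) this(2)]
    show "disjoint_reiteratively_hypercyclic (lp_topology p) (pseudo_shift f1 w1) (pseudo_shift f1 w2)"
      by (rule disjoint_reiteratively_hypercyclicI[OF p w decay1(1) decay2(1) decay1(2) decay2(2)
            disjoint_hypercyclic_imp_weight_ratio[OF p dh]])
  qed
qed

end
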